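(* Let $d=1$, let $p:\mathbb{Z}\to[0,1)$ satisfy $\sum_xp(x)=1$, $p(x)=0$ for $|x|>M$ for some $M<\infty$, and have span $1$ in the strong sense that for every $u\in\mathbb{Z}$ the smallest additive subgroup of $\mathbb{Z}$ containing $\{u+x:p(x)>0\}$ is $\mathbb{Z}$; let $\sigma_1^2=\sum_x(x-m_p)^2p(x)>0$ where $m_p=\sum_x xp(x)$. Let $\xi=\{\xi_t(x)\}$ be i.i.d. real with mean zero and variance $\sigma_\xi^2<\infty$. Let $V_0(0,x)=\mathbb{E}[\Delta_0(0)\Delta_0(x)]$. Then there exist constants $0<A,c<\infty$ such that $|V_0(0,x)|\le Ae^{-c|x|}$ for all $x\in\mathbb{Z}$, \[V_0(0,x)=\sigma_\xi^2[a(x-1)+a(x+1)-2a(x)]=\frac{\sigma_\xi^2}{\pi}\int_{-\pi}^{\pi}\frac{1-\cos\theta}{1-\phi_q(\theta)}e^{\iota\theta x}\,d\theta,\quad x\in\mathbb{Z},\] and $\sum_{x\in\mathbb{Z}}V_0(0,x)=\sigma_\xi^2/\sigma_1^2$, where the series converges absolutely.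
   Context: $p(x,y)=p(y-x)$ and $p^k$ denotes the $k$-step transition probability. $\Delta_0(x)=\sum_{k\ge 0}\sum_{z\in\mathbb{Z}}\xi_{-k}(z)(p^k(x,z)-p^k(x-1,z))$ (convergent a.s. and in $L^2$). $q(x,y)=\sum_z p(0,z)p(x,y+z)$ is the symmetrized kernel, $q^k$ its $k$-step transitions, $a(x)=\sum_{k=0}^\infty[q^k(0,0)-q^k(x,0)]$ its potential kernel, and $\phi_q(\theta)=\sum_x q(0,x)e^{\iota\theta x}$, with $\iota=\sqrt{-1}$. *)

theory Defs
  imports "HOL-Probability.Probability"
begin

definition int_subgroup_gen :: "int set \<Rightarrow> int set" where
  "int_subgroup_gen S = \<Inter>{G. S \<subseteq> G \<and> 0 \<in> G \<and> (\<forall>a\<in>G. \<forall>b\<in>G. a - b \<in> G)}"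

fun pk :: "(int \<Rightarrow> real) \<Rightarrow> nat \<Rightarrow> int \<Rightarrow> int \<Rightarrow> real" where
  "pk p 0 x y = (if x = y then 1 else 0)"
| "pk p (Suc k) x y = (\<Sum>\<^sub>\<infinity>z. p (z - x) * pk p k z y)"

definition qker :: "(int \<Rightarrow> real) \<Rightarrow> int \<Rightarrow> int \<Rightarrow> real" where
  "qker p x y = (\<Sum>\<^sub>\<infinity>z. p z * p (y + z - x))"

fun qk :: "(int \<Rightarrow> real) \<Rightarrow> nat \<Rightarrow> int \<Rightarrow> int \<Rightarrow> real" where
  "qk p 0 x y = (if x = y then 1 else 0)"
| "qk p (Suc k) x y = (\<Sum>\<^sub>\<infinity>z. qker p x z * qk p k z y)"

definition pot :: "(int \<Rightarrow> real) \<Rightarrow> int \<Rightarrow> real" where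
  "pot p x = (\<Sum>k. qk p k 0 0 - qk p k x 0)"

definition phi_q :: "(int \<Rightarrow> real) \<Rightarrow> real \<Rightarrow> complex" where
  "phi_q p \<theta> = (\<Sum>\<^sub>\<infinity>x. complex_of_real (qker p 0 x) * exp (\<i> * complex_of_real (\<theta> * real_of_int x)))"

definition mean_p :: "(int \<Rightarrow> real) \<Rightarrow> real" where
  "mean_p p = (\<Sum>\<^sub>\<infinity>x. real_of_int x * p x)"

definition var_p :: "(int \<Rightarrow> real) \<Rightarrow> real" where
  "var_p p = (\<Sum>\<^sub>\<infinity>x. (real_of_int x - mean_p p)^2 * p x)"

text \<open>Delta_0(x) = sum_{k>=0} sum_z xi_{-k}(z) (p^k(x,z) - p^k(x-1,z)).
  xi t z \<omega> is the noise at time t, site z.\<close>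
definition Delta0 :: "(int \<Rightarrow> real) \<Rightarrow> (int \<Rightarrow> int \<Rightarrow> 'a \<Rightarrow> real) \<Rightarrow> int \<Rightarrow> 'a \<Rightarrow> real" where
  "Delta0 p \<xi> x \<omega> =
     (\<Sum>k. \<Sum>\<^sub>\<infinity>z. \<xi> (- int k) z \<omega> * (pk p k x z - pk p k (x - 1) z))"

definition V0 :: "'a measure \<Rightarrow> (int \<Rightarrow> real) \<Rightarrow> (int \<Rightarrow> int \<Rightarrow> 'a \<Rightarrow> real) \<Rightarrow> int \<Rightarrow> real" where
  "V0 M p \<xi> x = (\<integral>\<omega>. Delta0 p \<xi> 0 \<omega> * Delta0 p \<xi> x \<omega> \<partial>M)"

end

theory Submission
  imports Defs
begin

text \<open>The layers of the double series defining Delta_0 are independent and centered, and their variances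
  are second differences of the k-step kernels q^k.  These are summable, so the series converges almost
  surely by Kolmogorov's theorem, and by Fatou's lemma the covariances may be summed termwise.
  In Fourier terms this gives the coefficients of (1 - cos) / (1 - phi_q).  For finite range, 1 - phi_q is
  1 - cos times a cosine polynomial R: each term 1 - cos n\<theta> is 1 - cos \<theta> times a squared modulus
  of a geometric sum.  Strong aperiodicity together with positive variance makes R positive on [-\<pi>, \<pi>],
  so all claims concern the Fourier coefficients of 1 / R: they decay exponentially
  because powers of a cosine polynomial are band limited, and their sum follows from
  R(0) = 2 \<sigma>_1^2.\<close>

section \<open>Kolmogorov's one-series theorem\<close>

text \<open>The outer sum in \<open>Delta0\<close> is a pointwise limit with an unspecified value
  wherever it diverges, so convergence of the partial sums in mean square does not determine it.
  Almost sure convergence therefore has to come first, and the mean square information is recovered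
  from the almost sure limit.

  On the Fourier side the obstacle is the zero of 1 - phi_q at the origin, where the integrand of
  the theorem is 0 / 0. Cancelling 1 - cos algebraically avoids any expansion near 0 and leaves
  continuous integrands with denominator \<open>R\<close>. What remains to be excluded is a second
  zero. Since q is the law of a difference of two independent steps, phi_q is nonnegative, and
  phi_q(t) = 1 with t \<noteq> 0 would put all differences of support points into a proper subgroup.
  This is why the span condition concerns the translates u + x: the walk with p(1) = p(-1) = 1/2
  generates the integers but has phi_q(pi) = 1.\<close>

lemma square_integrable_mult:
  fixes f g :: "'a \<Rightarrow> real"
  assumes [measurable]: "f \<in> borel_measurable M" "g \<in> borel_measurable M"
    and "integrable M (\<lambda>x. (f x)\<^sup>2)" "integrable M (\<lambda>x. (g x)\<^sup>2)"
  shows "integrable M (\<lambda>x. f x * g x)"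
proof (rule Bochner_Integration.integrable_bound)
  show "integrable M (\<lambda>x. (f x)\<^sup>2 + (g x)\<^sup>2)" using assms by simp
  have "\<bar>a * b\<bar> \<le> a\<^sup>2 + b\<^sup>2" for a b :: real
    using sum_squares_bound[of a b] sum_squares_bound[of a "-b"] zero_le_power2[of a] zero_le_power2[of b]
    by (simp add: abs_if)
  then show "AE x in M. norm (f x * g x) \<le> norm ((f x)\<^sup>2 + (g x)\<^sup>2)"
    by (auto intro!: AE_I2)
qed simp

lemma square_integrable_add:
  fixes f g :: "'a \<Rightarrow> real"
  assumes "f \<in> borel_measurable M" "g \<in> borel_measurable M"
    and "integrable M (\<lambda>x. (f x)\<^sup>2)" "integrable M (\<lambda>x. (g x)\<^sup>2)"
  shows "integrable M (\<lambda>x. (f x + g x)\<^sup>2)"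
proof -
  have "(\<lambda>x. (f x + g x)\<^sup>2) = (\<lambda>x. (f x)\<^sup>2 + (g x)\<^sup>2 + 2 * (f x * g x))"
    by (simp add: power2_sum mult.assoc)
  then show ?thesis using assms square_integrable_mult[OF assms] by simp
qed

lemma square_integrable_sum:
  fixes f :: "'i \<Rightarrow> 'a \<Rightarrow> real"
  assumes "\<And>i. i \<in> I \<Longrightarrow> f i \<in> borel_measurable M" "\<And>i. i \<in> I \<Longrightarrow> integrable M (\<lambda>x. (f i x)\<^sup>2)"
  shows "integrable M (\<lambda>x. (\<Sum>i\<in>I. f i x)\<^sup>2)"
  using assms
proof (induction I rule: infinite_finite_induct)
  case (insert i I)
  have m: "(\<lambda>x. \<Sum>i\<in>I. f i x) \<in> borel_measurable M"
    by (rule borel_measurable_sum) (use insert in auto)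
  have "integrable M (\<lambda>x. (f i x + (\<Sum>i\<in>I. f i x))\<^sup>2)"
    by (rule square_integrable_add[OF _ m]) (use insert in auto)
  then show ?case using insert by simp
qed auto

lemma (in finite_measure) square_integrable_integrable:
  fixes f :: "'a \<Rightarrow> real"
  assumes "f \<in> borel_measurable M" "integrable M (\<lambda>x. (f x)\<^sup>2)"
  shows "integrable M f"
  using square_integrable_mult[of f M "\<lambda>_. 1"] assms by simp

text \<open>The stopped sum is frozen once a partial sum reaches the level e, so that the maximal
  inequality becomes Chebyshev's inequality for a single variable.\<close>
definition stop_ind :: "real \<Rightarrow> (nat \<Rightarrow> real) \<Rightarrow> nat \<Rightarrow> real" where
  "stop_ind e f k = (if \<forall>j\<le>k. \<bar>\<Sum>i<j. f i\<bar> < e then 1 else 0)"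

definition stopped_sum :: "real \<Rightarrow> (nat \<Rightarrow> real) \<Rightarrow> nat \<Rightarrow> real" where
  "stopped_sum e f n = (\<Sum>k<n. stop_ind e f k * f k)"

text \<open>Predictability: the decision at time \<open>k\<close> reads only the terms before
  \<open>k\<close>. With the next lemma, a path may be replaced by its restriction to
  \<open>{..<n}\<close>, which makes the stopped sum and the next indicator functions of the
  past.\<close>

lemma stop_ind_cong: "(\<And>i. i < k \<Longrightarrow> f i = g i) \<Longrightarrow> stop_ind e f k = stop_ind e g k"
proof -
  assume *: "\<And>i. i < k \<Longrightarrow> f i = g i"
  have "(\<Sum>i<j. f i) = (\<Sum>i<j. g i)" if "j \<le> k" for j
    by (rule sum.cong) (use * that in auto)
  then show ?thesis by (simp add: stop_ind_def)
qed

lemma stopped_sum_cong: "(\<And>i. i < n \<Longrightarrow> f i = g i) \<Longrightarrow> stopped_sum e f n = stopped_sum e g n"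
proof -
  assume *: "\<And>i. i < n \<Longrightarrow> f i = g i"
  have "stop_ind e f k = stop_ind e g k" if "k < n" for k
    by (rule stop_ind_cong) (use * that in auto)
  then show ?thesis using * by (simp add: stopped_sum_def)
qed

text \<open>Before the first passage time \<open>t\<close> all indicators are 1. From
  \<open>t\<close> on they are 0, even if later partial sums fall below \<open>e\<close> again,
  because the condition ranges over all \<open>j \<le> k\<close>. So the stopped sum keeps the
  partial sum reached at \<open>t\<close>.\<close>

lemma stopped_sum_ge:
  assumes "j \<le> n" "\<bar>\<Sum>i<j. f i\<bar> \<ge> e" "e > 0"
  shows "\<bar>stopped_sum e f n\<bar> \<ge> e"
proof -
  define t where "t = (LEAST j. \<bar>\<Sum>i<j. f i\<bar> \<ge> e)"
  have t: "\<bar>\<Sum>i<t. f i\<bar> \<ge> e" unfolding t_def by (rule LeastI) (rule assms)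
  have lt: "\<bar>\<Sum>i<j. f i\<bar> < e" if "j < t" for j
    using not_less_Least[of j "\<lambda>j. \<bar>\<Sum>i<j. f i\<bar> \<ge> e"] that by (auto simp: t_def)
  have tn: "t \<le> n" using Least_le[of "\<lambda>j. \<bar>\<Sum>i<j. f i\<bar> \<ge> e" j] assms unfolding t_def by auto
  have ind: "stop_ind e f k = (if k < t then 1 else 0)" for k
    using lt t by (cases "k < t") (auto simp: stop_ind_def not_less not_le[symmetric])
  have "stopped_sum e f n = (\<Sum>k\<in>{..<n}. if k < t then f k else 0)"
    unfolding stopped_sum_def ind by (rule sum.cong) auto
  also have "\<dots> = (\<Sum>k\<in>{k\<in>{..<n}. k < t}. f k)" by (rule sum.inter_filter[symmetric]) simp
  also have "{k\<in>{..<n}. k < t} = {..<t}" using tn by auto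
  finally show ?thesis using t by simp
qed

text \<open>\<open>I\<close> is left open because two product spaces occur: \<open>UNIV\<close> for
  measurability on the sample space, and \<open>{..<n}\<close> for independence of the past from the
  next term.\<close>

lemma stop_ind_measurable [measurable]:
  assumes "{..<k} \<subseteq> I"
  shows "(\<lambda>f. stop_ind e f k) \<in> borel_measurable (Pi\<^sub>M I (\<lambda>_. borel))"
proof -
  have S: "(\<lambda>f. \<Sum>i<j. f i) \<in> borel_measurable (Pi\<^sub>M I (\<lambda>_. borel :: real measure))" if "j \<le> k" for j
    by (rule borel_measurable_sum, rule measurable_component_singleton) (use that assms in auto)
  have P: "{f \<in> space (Pi\<^sub>M I (\<lambda>_. borel)). \<bar>\<Sum>i<j. f i\<bar> < e} \<in> sets (Pi\<^sub>M I (\<lambda>_. borel))" if "j \<le> k" for j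
    by (rule borel_measurable_less[OF borel_measurable_abs[OF S[OF that]] borel_measurable_const])
  have "{f \<in> space (Pi\<^sub>M I (\<lambda>_. borel)). \<forall>j\<in>{..k}. \<bar>\<Sum>i<j. f i\<bar> < e} \<in> sets (Pi\<^sub>M I (\<lambda>_. borel))"
    by (rule sets.sets_Collect_finite_All[OF P finite_atMost]) simp
  then have "{f \<in> space (Pi\<^sub>M I (\<lambda>_. borel)). \<forall>j\<le>k. \<bar>\<Sum>i<j. f i\<bar> < e} \<in> sets (Pi\<^sub>M I (\<lambda>_. borel))"
    by (simp only: Ball_def atMost_iff)
  from measurable_If[OF borel_measurable_const borel_measurable_const this]
  show ?thesis unfolding stop_ind_def .
qed

section \<open>Orthogonality, the maximal inequality and convergence of independent series\<close>

context prob_space begin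

text \<open>Orthogonality of martingale differences. The past enters through a measurable
  \<open>g\<close> on the product space, so that one lemma serves both the plain and the stopped
  partial sums.\<close>

lemma indep_centered_mult_zero:
  fixes X :: "nat \<Rightarrow> 'a \<Rightarrow> real"
  assumes ind: "indep_vars (\<lambda>_. borel) X UNIV"
    and g: "g \<in> borel_measurable (Pi\<^sub>M {..<n} (\<lambda>_. borel))"
    and gint: "integrable M (\<lambda>\<omega>. g (restrict (\<lambda>i. X i \<omega>) {..<n}))"
    and int: "integrable M (X n)" and mean: "expectation (X n) = 0"
  shows "expectation (\<lambda>\<omega>. g (restrict (\<lambda>i. X i \<omega>) {..<n}) * X n \<omega>) = 0"
proof -
  have "indep_var (Pi\<^sub>M {..<n} (\<lambda>_. borel)) (\<lambda>\<omega>. restrict (\<lambda>i. X i \<omega>) {..<n})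
     (Pi\<^sub>M {n} (\<lambda>_. borel)) (\<lambda>\<omega>. restrict (\<lambda>i. X i \<omega>) {n})"
    by (rule indep_var_restrict[OF ind]) auto
  then have "indep_var borel (g \<circ> (\<lambda>\<omega>. restrict (\<lambda>i. X i \<omega>) {..<n}))
     borel ((\<lambda>f. f n) \<circ> (\<lambda>\<omega>. restrict (\<lambda>i. X i \<omega>) {n}))"
    by (rule indep_var_compose) (use g in auto)
  then have "indep_var borel (\<lambda>\<omega>. g (restrict (\<lambda>i. X i \<omega>) {..<n})) borel (X n)"
    by (simp add: comp_def)
  from indep_var_lebesgue_integral[OF this gint int] show ?thesis using mean by simp
qed

text \<open>The stopped sum is a martingale transform with coefficients in {0, 1}: the cross terms
  vanish by orthogonality, and each diagonal term can only shrink.\<close>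

lemma stopped_sum_second_moment:
  fixes X :: "nat \<Rightarrow> 'a \<Rightarrow> real"
  assumes ind: "indep_vars (\<lambda>_. borel) X UNIV"
    and sq: "\<And>n. integrable M (\<lambda>\<omega>. (X n \<omega>)\<^sup>2)" and mean: "\<And>n. expectation (X n) = 0"
  shows "integrable M (\<lambda>\<omega>. (stopped_sum e (\<lambda>i. X i \<omega>) n)\<^sup>2)"
    and "expectation (\<lambda>\<omega>. (stopped_sum e (\<lambda>i. X i \<omega>) n)\<^sup>2) \<le> (\<Sum>k<n. expectation (\<lambda>\<omega>. (X k \<omega>)\<^sup>2))"
proof -
  have rv[measurable]: "X i \<in> borel_measurable M" for i using ind by (auto simp: indep_vars_def)
  have int: "integrable M (X i)" for i by (rule square_integrable_integrable[OF rv sq])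
  define H where "H k \<omega> = stop_ind e (\<lambda>i. X i \<omega>) k" for k \<omega>
  have Hm[measurable]: "H k \<in> borel_measurable M" for k
  proof -
    have "(\<lambda>f. stop_ind e f k) \<circ> (\<lambda>\<omega>. \<lambda>i\<in>UNIV. X i \<omega>) \<in> borel_measurable M"
      by (rule measurable_comp[OF measurable_restrict stop_ind_measurable]) auto
    then show ?thesis by (simp add: H_def[abs_def] comp_def restrict_UNIV)
  qed
  have H01: "H k \<omega> = 0 \<or> H k \<omega> = 1" for k \<omega> by (simp add: H_def stop_ind_def)
  have Hsq: "integrable M (\<lambda>\<omega>. (H k \<omega> * f \<omega>)\<^sup>2)" 
    if "integrable M (\<lambda>\<omega>. (f \<omega>)\<^sup>2)" "f \<in> borel_measurable M" for k and f :: "'a \<Rightarrow> real"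
  proof (rule Bochner_Integration.integrable_bound[OF that(1)])
    show "AE x in M. norm ((H k x * f x)\<^sup>2) \<le> norm ((f x)\<^sup>2)"
    proof (rule AE_I2)
      show "norm ((H k x * f x)\<^sup>2) \<le> norm ((f x)\<^sup>2)" for x using H01[of k x] by auto
    qed
  qed (use that(2) in \<open>auto intro!: borel_measurable_power borel_measurable_times\<close>)
  define T where "T n \<omega> = stopped_sum e (\<lambda>i. X i \<omega>) n" for n \<omega>
  have TS: "T n \<omega> = (\<Sum>k<n. H k \<omega> * X k \<omega>)" for n \<omega> by (simp add: T_def stopped_sum_def H_def)
  have Tm[measurable]: "T n \<in> borel_measurable M" for n unfolding TS[abs_def] by measurable
  have Tsq: "integrable M (\<lambda>\<omega>. (T n \<omega>)\<^sup>2)" for n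
    unfolding TS by (rule square_integrable_sum) (auto intro: Hsq sq)
  then show "integrable M (\<lambda>\<omega>. (stopped_sum e (\<lambda>i. X i \<omega>) n)\<^sup>2)" by (simp add: T_def)
  have "expectation (\<lambda>\<omega>. (T n \<omega>)\<^sup>2) \<le> (\<Sum>k<n. expectation (\<lambda>\<omega>. (X k \<omega>)\<^sup>2))"
  proof (induction n)
    case (Suc n)
    \<comment> \<open>The factor \<open>stop_ind e f n\<close> decides whether term \<open>n\<close>
      is still added. It reads only the first \<open>n\<close> coordinates, so all of
      \<open>?g\<close> is independent of \<open>X n\<close>.\<close>
    let ?g = "\<lambda>f. stopped_sum e f n * stop_ind e f n"
    have gm: "?g \<in> borel_measurable (Pi\<^sub>M {..<n} (\<lambda>_. borel))"
      unfolding stopped_sum_def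
      by (intro borel_measurable_times borel_measurable_sum stop_ind_measurable measurable_component_singleton) auto
    have geq: "?g (restrict (\<lambda>i. X i \<omega>) {..<n}) = T n \<omega> * H n \<omega>" for \<omega>
      unfolding T_def H_def by (intro arg_cong2[where f="(*)"] stopped_sum_cong stop_ind_cong) simp_all
    have THi: "integrable M (\<lambda>\<omega>. T n \<omega> * H n \<omega>)"
      using square_integrable_integrable[OF _ Hsq[OF Tsq Tm, of n n]] by (simp add: mult.commute)
    have z: "expectation (\<lambda>\<omega>. (T n \<omega> * H n \<omega>) * X n \<omega>) = 0"
      using indep_centered_mult_zero[OF ind gm _ int mean] THi by (simp add: geq)
    have zi: "integrable M (\<lambda>\<omega>. (T n \<omega> * H n \<omega>) * X n \<omega>)"
      using square_integrable_mult[OF _ _ Hsq[OF Tsq Tm, of n n] sq[of n]] by (simp add: mult.commute)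
    have "(T (Suc n) \<omega>)\<^sup>2 = (T n \<omega>)\<^sup>2 + (H n \<omega> * X n \<omega>)\<^sup>2 + 2 * ((T n \<omega> * H n \<omega>) * X n \<omega>)" for \<omega>
      by (simp add: TS power2_sum)
    then have "expectation (\<lambda>\<omega>. (T (Suc n) \<omega>)\<^sup>2) = expectation (\<lambda>\<omega>. (T n \<omega>)\<^sup>2) + expectation (\<lambda>\<omega>. (H n \<omega> * X n \<omega>)\<^sup>2)"
      using Tsq Hsq[OF sq rv] zi z by simp
    also have "expectation (\<lambda>\<omega>. (H n \<omega> * X n \<omega>)\<^sup>2) \<le> expectation (\<lambda>\<omega>. (X n \<omega>)\<^sup>2)"
    proof (rule integral_mono[OF Hsq[OF sq rv] sq])
      show "(H n \<omega> * X n \<omega>)\<^sup>2 \<le> (X n \<omega>)\<^sup>2" for \<omega> using H01[of n \<omega>] by auto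
    qed
    finally show ?case using Suc by simp
  qed (simp add: TS)
  then show "expectation (\<lambda>\<omega>. (stopped_sum e (\<lambda>i. X i \<omega>) n)\<^sup>2) \<le> (\<Sum>k<n. expectation (\<lambda>\<omega>. (X k \<omega>)\<^sup>2))"
    by (simp add: T_def)
qed

lemma indep_sum_second_moment:
  fixes X :: "nat \<Rightarrow> 'a \<Rightarrow> real"
  assumes ind: "indep_vars (\<lambda>_. borel) X UNIV"
    and sq: "\<And>n. integrable M (\<lambda>\<omega>. (X n \<omega>)\<^sup>2)" and mean: "\<And>n. expectation (X n) = 0"
  shows "expectation (\<lambda>\<omega>. (\<Sum>k<n. X k \<omega>)\<^sup>2) = (\<Sum>k<n. expectation (\<lambda>\<omega>. (X k \<omega>)\<^sup>2))"
proof (induction n)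
  case (Suc n)
  have rv[measurable]: "X i \<in> borel_measurable M" for i using ind by (auto simp: indep_vars_def)
  have int: "integrable M (X i)" for i by (rule square_integrable_integrable[OF rv sq])
  have Ssq: "integrable M (\<lambda>\<omega>. (\<Sum>k<n. X k \<omega>)\<^sup>2)" by (rule square_integrable_sum) (auto intro: sq)
  have z: "expectation (\<lambda>\<omega>. (\<Sum>k<n. X k \<omega>) * X n \<omega>) = 0"
    using indep_centered_mult_zero[OF ind, of "\<lambda>f. \<Sum>k<n. f k" n] int mean by simp
  have zi: "integrable M (\<lambda>\<omega>. (\<Sum>k<n. X k \<omega>) * X n \<omega>)"
    by (rule square_integrable_mult[OF _ _ Ssq sq]) auto
  have "(\<Sum>k<Suc n. X k \<omega>)\<^sup>2 = (\<Sum>k<n. X k \<omega>)\<^sup>2 + (X n \<omega>)\<^sup>2 + 2 * ((\<Sum>k<n. X k \<omega>) * X n \<omega>)" for \<omega>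
    by (simp add: power2_sum)
  then show ?case using Ssq sq zi z Suc by simp
qed simp

lemma kolmogorov_maximal_inequality:
  fixes X :: "nat \<Rightarrow> 'a \<Rightarrow> real"
  assumes ind: "indep_vars (\<lambda>_. borel) X UNIV"
    and sq: "\<And>n. integrable M (\<lambda>\<omega>. (X n \<omega>)\<^sup>2)" and mean: "\<And>n. expectation (X n) = 0" and e: "e > 0"
  shows "prob {\<omega>\<in>space M. \<exists>j\<le>n. e \<le> \<bar>\<Sum>i<j. X i \<omega>\<bar>} \<le> (\<Sum>k<n. expectation (\<lambda>\<omega>. (X k \<omega>)\<^sup>2)) / e\<^sup>2"
proof -
  have rv[measurable]: "X i \<in> borel_measurable M" for i using ind by (auto simp: indep_vars_def)
  note T = stopped_sum_second_moment[OF ind sq mean, of e n]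
  have "prob {\<omega>\<in>space M. \<exists>j\<le>n. e \<le> \<bar>\<Sum>i<j. X i \<omega>\<bar>} \<le> 
      prob {\<omega>\<in>space M. e\<^sup>2 \<le> (stopped_sum e (\<lambda>i. X i \<omega>) n)\<^sup>2}"
  proof (rule finite_measure_mono)
    show "{\<omega>\<in>space M. \<exists>j\<le>n. e \<le> \<bar>\<Sum>i<j. X i \<omega>\<bar>} \<subseteq> {\<omega>\<in>space M. e\<^sup>2 \<le> (stopped_sum e (\<lambda>i. X i \<omega>) n)\<^sup>2}"
    proof safe
      fix \<omega> j assume "j \<le> n" "e \<le> \<bar>\<Sum>i<j. X i \<omega>\<bar>"
      then have "e \<le> \<bar>stopped_sum e (\<lambda>i. X i \<omega>) n\<bar>" by (rule stopped_sum_ge[OF _ _ e])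
      then have "e\<^sup>2 \<le> \<bar>stopped_sum e (\<lambda>i. X i \<omega>) n\<bar>\<^sup>2" using e by (intro power_mono) auto
      then show "e\<^sup>2 \<le> (stopped_sum e (\<lambda>i. X i \<omega>) n)\<^sup>2" by simp
    qed
    show "{\<omega>\<in>space M. e\<^sup>2 \<le> (stopped_sum e (\<lambda>i. X i \<omega>) n)\<^sup>2} \<in> sets M"
      using borel_measurable_integrable[OF T(1)] by measurable
  qed
  also have "\<dots> \<le> expectation (\<lambda>\<omega>. (stopped_sum e (\<lambda>i. X i \<omega>) n)\<^sup>2) / e\<^sup>2"
    using integral_Markov_inequality_measure[OF T(1), of "{}" "e\<^sup>2"] e by simp
  also have "\<dots> \<le> (\<Sum>k<n. expectation (\<lambda>\<omega>. (X k \<omega>)\<^sup>2)) / e\<^sup>2"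
    using T(2) e by (simp add: divide_right_mono)
  finally show ?thesis .
qed


text \<open>With the first \<open>m\<close> terms replaced by 0, the difference of two partial sums
  is a partial sum again, and the estimates for sums from 0 apply to tails without
  reindexing.\<close>

lemma indep_vars_discard_initial:
  fixes X :: "nat \<Rightarrow> 'a \<Rightarrow> real"
  assumes "indep_vars (\<lambda>_. borel) X UNIV"
  shows "indep_vars (\<lambda>_. borel) (\<lambda>i. if i < m then (\<lambda>_. 0) else X i) UNIV"
proof -
  have "indep_vars (\<lambda>_. borel) (\<lambda>i \<omega>. (\<lambda>x. if i < m then 0 else x) (X i \<omega>)) UNIV"
    by (rule indep_vars_compose2[OF assms]) simp
  moreover have "(\<lambda>i \<omega>. (\<lambda>x. if i < m then 0 else x) (X i \<omega>)) = (\<lambda>i. if i < m then (\<lambda>_. 0) else X i)"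
    by (auto simp: fun_eq_iff)
  ultimately show ?thesis by simp
qed

lemma sum_discard_initial:
  fixes X :: "nat \<Rightarrow> 'a \<Rightarrow> real"
  assumes "m \<le> n"
  shows "(\<Sum>i<n. (if i < m then (\<lambda>_. 0) else X i) \<omega>) = (\<Sum>i<n. X i \<omega>) - (\<Sum>i<m. X i \<omega>)"
  using assms by (induction n rule: dec_induct) simp_all

theorem kolmogorov_one_series:
  fixes X :: "nat \<Rightarrow> 'a \<Rightarrow> real"
  assumes ind: "indep_vars (\<lambda>_. borel) X UNIV"
    and sq: "\<And>n. integrable M (\<lambda>\<omega>. (X n \<omega>)\<^sup>2)" and mean: "\<And>n. expectation (X n) = 0"
    and summ: "summable (\<lambda>n. expectation (\<lambda>\<omega>. (X n \<omega>)\<^sup>2))"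
  shows "AE \<omega> in M. summable (\<lambda>n. X n \<omega>)"
proof -
  have rv[measurable]: "X i \<in> borel_measurable M" for i using ind by (auto simp: indep_vars_def)
  define v where "v n = expectation (\<lambda>\<omega>. (X n \<omega>)\<^sup>2)" for n
  have v0: "v n \<ge> 0" for n by (simp add: v_def)
  have vs: "summable v" using summ by (simp add: v_def[abs_def])
  define S where "S n \<omega> = (\<Sum>i<n. X i \<omega>)" for n \<omega>
  have [measurable]: "S n \<in> borel_measurable M" for n unfolding S_def[abs_def] by measurable
  define B where "B e m n = {\<omega>\<in>space M. \<exists>j\<in>{m..n}. e \<le> \<bar>S j \<omega> - S m \<omega>\<bar>}" for e m n
  have Bm[measurable]: "B e m n \<in> sets M" for e m n unfolding B_def by measurable
  have Bprob: "prob (B e m n) \<le> (\<Sum>k. v (k + m)) / e\<^sup>2" if e: "e > 0" for e m n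
  proof -
    define Y where "Y i = (if i < m then (\<lambda>_. 0) else X i)" for i
    have Yi: "indep_vars (\<lambda>_. borel) Y UNIV"
      unfolding Y_def by (rule indep_vars_discard_initial[OF ind])
    have Ysq: "integrable M (\<lambda>\<omega>. (Y i \<omega>)\<^sup>2)" for i by (simp add: Y_def sq)
    have Ymean: "expectation (Y i) = 0" for i by (simp add: Y_def mean)
    have Ysum: "(\<Sum>i<j. Y i \<omega>) = S j \<omega> - S m \<omega>" if "m \<le> j" for j \<omega>
      unfolding Y_def S_def by (rule sum_discard_initial[OF that])
    have "prob (B e m n) \<le> prob {\<omega>\<in>space M. \<exists>j\<le>n. e \<le> \<bar>\<Sum>i<j. Y i \<omega>\<bar>}"
    proof (rule finite_measure_mono)
      show "B e m n \<subseteq> {\<omega>\<in>space M. \<exists>j\<le>n. e \<le> \<bar>\<Sum>i<j. Y i \<omega>\<bar>}"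
        by (auto simp: B_def Ysum[symmetric])
      have [measurable]: "Y i \<in> borel_measurable M" for i by (simp add: Y_def)
      show "{\<omega>\<in>space M. \<exists>j\<le>n. e \<le> \<bar>\<Sum>i<j. Y i \<omega>\<bar>} \<in> sets M" by measurable
    qed
    also have "\<dots> \<le> (\<Sum>k<n. expectation (\<lambda>\<omega>. (Y k \<omega>)\<^sup>2)) / e\<^sup>2"
      by (rule kolmogorov_maximal_inequality[OF Yi Ysq Ymean e])
    also have "(\<Sum>k<n. expectation (\<lambda>\<omega>. (Y k \<omega>)\<^sup>2)) = (\<Sum>k\<in>{m..<n}. v k)"
      by (rule sum.mono_neutral_cong_right) (auto simp: Y_def v_def)
    also have "\<dots> \<le> (\<Sum>k. v (k + m))"
    proof -
      have "(\<Sum>k\<in>{m..<n}. v k) \<le> (\<Sum>k\<in>{m..<m+n}. v k)"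
        by (rule sum_mono2) (auto simp: v0)
      also have "\<dots> = (\<Sum>k<n. v (k + m))"
        using sum.shift_bounds_nat_ivl[of v 0 m n] by (simp add: add.commute lessThan_atLeast0)
      also have "\<dots> \<le> (\<Sum>k. v (k + m))"
        by (rule sum_le_suminf) (auto simp: v0 summable_iff_shift[of v m] vs)
      finally show ?thesis .
    qed
    finally show ?thesis using e by (simp add: divide_right_mono)
  qed
  \<comment> \<open>The bound on \<open>B e m n\<close> does not depend on \<open>n\<close>, so it
    passes to the increasing union, the event that the partial sums ever move by \<open>e\<close>
    after time \<open>m\<close>.\<close>
  define U where "U e m = (\<Union>n. B e m n)" for e m
  have Um[measurable]: "U e m \<in> sets M" for e m unfolding U_def by measurable
  have Uprob: "prob (U e m) \<le> (\<Sum>k. v (k + m)) / e\<^sup>2" if e: "e > 0" for e m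
  proof -
    have "(\<lambda>n. prob (B e m n)) \<longlonglongrightarrow> prob (U e m)" unfolding U_def
      by (rule finite_Lim_measure_incseq) (auto simp: incseq_def B_def)
    then show ?thesis by (rule LIMSEQ_le_const2) (use Bprob[OF e] in auto)
  qed
  have tail: "(\<lambda>m. \<Sum>k. v (k + m)) \<longlonglongrightarrow> 0" using suminf_exist_split2[OF vs] .
  have null: "AE \<omega> in M. \<exists>m. \<omega> \<notin> U e m" if e: "e > 0" for e
  proof -
    have "prob (\<Inter>m. U e m) \<le> (\<Sum>k. v (k + m)) / e\<^sup>2" for m
      by (rule order_trans[OF finite_measure_mono Uprob[OF e, of m]]) auto
    moreover have "(\<lambda>m. (\<Sum>k. v (k + m)) / e\<^sup>2) \<longlonglongrightarrow> 0" using tendsto_divide[OF tail tendsto_const[of "e\<^sup>2"]] e by simp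
    ultimately have "prob (\<Inter>m. U e m) \<le> 0" by (intro LIMSEQ_le_const) auto
    then have "prob (\<Inter>m. U e m) = 0" by (simp add: measure_le_0_iff)
    moreover have "(\<Inter>m. U e m) \<in> sets M" by measurable
    ultimately have "(\<Inter>m. U e m) \<in> null_sets M" by (simp add: null_sets_def emeasure_eq_measure)
    then show ?thesis by (rule AE_I') auto
  qed
  \<comment> \<open>Countably many levels tending to 0 suffice for the Cauchy criterion, so the
    exceptional null sets can be united.\<close>
  have "AE \<omega> in M. \<forall>r::nat. \<exists>m. \<omega> \<notin> U (1 / Suc r) m"
    unfolding AE_all_countable using null by simp
  then show ?thesis
  proof (rule AE_mp, intro AE_I2 impI)
    fix \<omega> assume w: "\<omega> \<in> space M" and *: "\<forall>r::nat. \<exists>m. \<omega> \<notin> U (1 / Suc r) m"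
    have "Cauchy (\<lambda>n. S n \<omega>)"
    proof (rule metric_CauchyI)
      fix e :: real assume "e > 0"
      then obtain r where r: "1 / real (Suc r) < e / 2" using nat_approx_posE[of "e/2"] by auto
      obtain m where m: "\<omega> \<notin> U (1 / Suc r) m" using * by blast
      have b: "\<bar>S j \<omega> - S m \<omega>\<bar> < e / 2" if "j \<ge> m" for j
      proof -
        have "\<omega> \<notin> B (1 / Suc r) m j" using m by (auto simp: U_def)
        then have "\<bar>S j \<omega> - S m \<omega>\<bar> < 1 / Suc r" using w that by (auto simp: B_def not_le)
        then show ?thesis using r by simp
      qed
      have "dist (S i \<omega>) (S j \<omega>) < e" if "i \<ge> m" "j \<ge> m" for i j
        using b[OF that(1)] b[OF that(2)] unfolding dist_real_def by linarith
      then show "\<exists>N. \<forall>i\<ge>N. \<forall>j\<ge>N. dist (S i \<omega>) (S j \<omega>) < e" by blast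
    qed
    then show "summable (\<lambda>n. X n \<omega>)"
      by (simp add: summable_iff_convergent Cauchy_convergent_iff S_def)
  qed
qed

text \<open>Fatou's lemma gives inequalities only. For \<open>n = 0\<close> it yields integrability
  and the upper bound; the lower bound comes from the smallness of the error \<open>L - S n\<close>
  for large \<open>n\<close>.\<close>

theorem indep_series_second_moment:
  fixes X :: "nat \<Rightarrow> 'a \<Rightarrow> real"
  assumes ind: "indep_vars (\<lambda>_. borel) X UNIV"
    and sq: "\<And>n. integrable M (\<lambda>\<omega>. (X n \<omega>)\<^sup>2)" and mean: "\<And>n. expectation (X n) = 0"
    and summ: "summable (\<lambda>n. expectation (\<lambda>\<omega>. (X n \<omega>)\<^sup>2))"
  shows "integrable M (\<lambda>\<omega>. (\<Sum>n. X n \<omega>)\<^sup>2)"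
    and "expectation (\<lambda>\<omega>. (\<Sum>n. X n \<omega>)\<^sup>2) = (\<Sum>n. expectation (\<lambda>\<omega>. (X n \<omega>)\<^sup>2))"
proof -
  have rv[measurable]: "X i \<in> borel_measurable M" for i using ind by (auto simp: indep_vars_def)
  define v where "v n = expectation (\<lambda>\<omega>. (X n \<omega>)\<^sup>2)" for n
  have v0: "v n \<ge> 0" for n by (simp add: v_def)
  have vs: "summable v" using summ by (simp add: v_def[abs_def])
  define S where "S n \<omega> = (\<Sum>i<n. X i \<omega>)" for n \<omega>
  define L where "L \<omega> = (\<Sum>n. X n \<omega>)" for \<omega>
  have [measurable]: "S n \<in> borel_measurable M" for n unfolding S_def[abs_def] by measurable
  have Lm[measurable]: "L \<in> borel_measurable M" unfolding L_def[abs_def] by measurable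
  have Ssq: "integrable M (\<lambda>\<omega>. (S n \<omega>)\<^sup>2)" for n
    unfolding S_def by (rule square_integrable_sum) (auto intro: sq)
  have SL: "AE \<omega> in M. (\<lambda>n. S n \<omega>) \<longlonglongrightarrow> L \<omega>"
    using kolmogorov_one_series[OF assms] by (rule AE_mp) (auto intro!: AE_I2 simp: S_def L_def summable_LIMSEQ)
  have diff: "integrable M (\<lambda>\<omega>. (S m \<omega> - S n \<omega>)\<^sup>2)"
      "expectation (\<lambda>\<omega>. (S m \<omega> - S n \<omega>)\<^sup>2) \<le> (\<Sum>k. v (k + n))" if nm: "n \<le> m" for m n
  proof -
    define Y where "Y i = (if i < n then (\<lambda>_. 0) else X i)" for i
    have Yi: "indep_vars (\<lambda>_. borel) Y UNIV"
      unfolding Y_def by (rule indep_vars_discard_initial[OF ind])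
    have Ysq: "integrable M (\<lambda>\<omega>. (Y i \<omega>)\<^sup>2)" for i by (simp add: Y_def sq)
    have Ymean: "expectation (Y i) = 0" for i by (simp add: Y_def mean)
    have Ysum: "(\<Sum>i<m. Y i \<omega>) = S m \<omega> - S n \<omega>" for \<omega>
      unfolding Y_def S_def by (rule sum_discard_initial[OF nm])
    show "integrable M (\<lambda>\<omega>. (S m \<omega> - S n \<omega>)\<^sup>2)"
      unfolding Ysum[symmetric] by (rule square_integrable_sum) (use Ysq in \<open>auto simp: Y_def sq\<close>)
    have "expectation (\<lambda>\<omega>. (S m \<omega> - S n \<omega>)\<^sup>2) = (\<Sum>k<m. expectation (\<lambda>\<omega>. (Y k \<omega>)\<^sup>2))"
      using indep_sum_second_moment[OF Yi Ysq Ymean, of m] by (simp add: Ysum)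
    also have "\<dots> = (\<Sum>k\<in>{n..<m}. v k)"
      by (rule sum.mono_neutral_cong_right) (auto simp: Y_def v_def)
    also have "\<dots> = (\<Sum>k<m-n. v (k + n))"
      using sum.shift_bounds_nat_ivl[of v 0 n "m-n"] nm by (simp add: add.commute lessThan_atLeast0)
    also have "\<dots> \<le> (\<Sum>k. v (k + n))"
      by (rule sum_le_suminf) (auto simp: v0 summable_iff_shift[of v n] vs)
    finally show "expectation (\<lambda>\<omega>. (S m \<omega> - S n \<omega>)\<^sup>2) \<le> (\<Sum>k. v (k + n))" .
  qed
  have r0: "(\<Sum>k. v (k + n)) \<ge> 0" for n
    by (rule suminf_nonneg) (auto simp: v0 summable_iff_shift[of v n] vs)
  \<comment> \<open>The differences \<open>S (m + n) - S n\<close> are bounded in mean square by the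
    variance tail, uniformly in \<open>m\<close>. Fatou's lemma carries this bound to the almost
    sure limit, so no separate L2 limit has to be constructed and identified.\<close>
  have fatou: "(\<integral>\<^sup>+\<omega>. ennreal ((L \<omega> - S n \<omega>)\<^sup>2) \<partial>M) \<le> ennreal (\<Sum>k. v (k + n))" for n
  proof -
    have "(\<integral>\<^sup>+\<omega>. ennreal ((L \<omega> - S n \<omega>)\<^sup>2) \<partial>M) = (\<integral>\<^sup>+\<omega>. liminf (\<lambda>m. ennreal ((S (m + n) \<omega> - S n \<omega>)\<^sup>2)) \<partial>M)"
    proof (rule nn_integral_cong_AE, rule AE_mp[OF SL], intro AE_I2 impI)
      fix \<omega> assume "(\<lambda>n. S n \<omega>) \<longlonglongrightarrow> L \<omega>"
      then have "(\<lambda>m. ennreal ((S (m + n) \<omega> - S n \<omega>)\<^sup>2)) \<longlonglongrightarrow> ennreal ((L \<omega> - S n \<omega>)\<^sup>2)"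
        by (intro tendsto_ennrealI tendsto_intros LIMSEQ_ignore_initial_segment)
      then show "ennreal ((L \<omega> - S n \<omega>)\<^sup>2) = liminf (\<lambda>m. ennreal ((S (m + n) \<omega> - S n \<omega>)\<^sup>2))"
        by (rule lim_imp_Liminf[OF trivial_limit_sequentially, symmetric])
    qed
    also have "\<dots> \<le> liminf (\<lambda>m. \<integral>\<^sup>+\<omega>. ennreal ((S (m + n) \<omega> - S n \<omega>)\<^sup>2) \<partial>M)"
      by (rule nn_integral_liminf) measurable
    also have "\<dots> \<le> liminf (\<lambda>m. ennreal (\<Sum>k. v (k + n)))"
    proof (intro Liminf_mono always_eventually allI)
      fix m
      show "(\<integral>\<^sup>+\<omega>. ennreal ((S (m + n) \<omega> - S n \<omega>)\<^sup>2) \<partial>M) \<le> ennreal (\<Sum>k. v (k + n))"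
        using diff[of n "m + n"] by (simp add: nn_integral_eq_integral ennreal_leI)
    qed
    finally show ?thesis by (simp add: Liminf_const)
  qed
  have Dint: "integrable M (\<lambda>\<omega>. (L \<omega> - S n \<omega>)\<^sup>2)" for n
    by (rule integrableI_nonneg) (use fatou[of n] in \<open>auto intro: le_less_trans\<close>)
  have Dle: "expectation (\<lambda>\<omega>. (L \<omega> - S n \<omega>)\<^sup>2) \<le> (\<Sum>k. v (k + n))" for n
    using fatou[of n] Dint[of n] r0[of n] by (simp add: nn_integral_eq_integral ennreal_le_iff)
  have Lint: "integrable M (\<lambda>\<omega>. (L \<omega>)\<^sup>2)" using Dint[of 0] by (simp add: S_def)
  then show "integrable M (\<lambda>\<omega>. (\<Sum>n. X n \<omega>)\<^sup>2)" by (simp add: L_def)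
  have up: "expectation (\<lambda>\<omega>. (L \<omega>)\<^sup>2) \<le> suminf v" using Dle[of 0] by (simp add: S_def)
  have tail: "(\<lambda>m. \<Sum>k. v (k + m)) \<longlonglongrightarrow> 0" using suminf_exist_split2[OF vs] .
  \<comment> \<open>The weighted inequality \<open>ineq\<close> replaces the triangle inequality in
    L2. The order of limits matters: for fixed \<open>e\<close> the term with 1 / e disappears as
    \<open>n\<close> grows, and only then does \<open>e\<close> tend to 0.\<close>
  have low: "suminf v \<le> (1 + e) * expectation (\<lambda>\<omega>. (L \<omega>)\<^sup>2)" if e: "e > 0" for e
  proof -
    have "(\<Sum>k<n. v k) \<le> (1 + e) * expectation (\<lambda>\<omega>. (L \<omega>)\<^sup>2) + (1 + 1/e) * (\<Sum>k. v (k + n))" for n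
    proof -
      have ineq: "a\<^sup>2 \<le> (1 + e) * b\<^sup>2 + (1 + 1/e) * (b - a)\<^sup>2" for a b :: real
      proof -
        have "(1 + e) * b\<^sup>2 + (1 + 1/e) * (b - a)\<^sup>2 - a\<^sup>2 = (e * b + (b - a))\<^sup>2 / e"
          using e by (simp add: field_simps power2_eq_square)
        moreover have "\<dots> \<ge> 0" using e by simp
        ultimately show ?thesis by linarith
      qed
      have "(\<Sum>k<n. v k) = expectation (\<lambda>\<omega>. (S n \<omega>)\<^sup>2)"
        using indep_sum_second_moment[OF ind sq mean, of n] by (simp add: v_def S_def)
      also have "\<dots> \<le> expectation (\<lambda>\<omega>. (1 + e) * (L \<omega>)\<^sup>2 + (1 + 1/e) * (L \<omega> - S n \<omega>)\<^sup>2)"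
        by (rule integral_mono) (use ineq Ssq Lint Dint in auto)
      also have "\<dots> = (1 + e) * expectation (\<lambda>\<omega>. (L \<omega>)\<^sup>2) + (1 + 1/e) * expectation (\<lambda>\<omega>. (L \<omega> - S n \<omega>)\<^sup>2)"
        using Lint Dint by simp
      also have "\<dots> \<le> (1 + e) * expectation (\<lambda>\<omega>. (L \<omega>)\<^sup>2) + (1 + 1/e) * (\<Sum>k. v (k + n))"
        using Dle[of n] e by (intro add_left_mono mult_left_mono) auto
      finally show ?thesis .
    qed
    moreover have "(\<lambda>n. (1 + e) * expectation (\<lambda>\<omega>. (L \<omega>)\<^sup>2) + (1 + 1/e) * (\<Sum>k. v (k + n))) \<longlonglongrightarrow>
       (1 + e) * expectation (\<lambda>\<omega>. (L \<omega>)\<^sup>2) + (1 + 1/e) * 0"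
      by (intro tendsto_intros tail)
    ultimately show ?thesis using summable_LIMSEQ[OF vs] by (intro LIMSEQ_le) auto
  qed
  have "suminf v \<le> expectation (\<lambda>\<omega>. (L \<omega>)\<^sup>2)"
  proof (rule tendsto_lowerbound)
    show "((\<lambda>e. (1 + e) * expectation (\<lambda>\<omega>. (L \<omega>)\<^sup>2)) \<longlongrightarrow> expectation (\<lambda>\<omega>. (L \<omega>)\<^sup>2)) (at_right 0)"
      by (auto intro!: tendsto_eq_intros)
    show "\<forall>\<^sub>F e in at_right 0. suminf v \<le> (1 + e) * expectation (\<lambda>\<omega>. (L \<omega>)\<^sup>2)"
      using low by (auto simp: eventually_at_right_field intro!: exI[of _ 1])
  qed simp
  then show "expectation (\<lambda>\<omega>. (\<Sum>n. X n \<omega>)\<^sup>2) = (\<Sum>n. expectation (\<lambda>\<omega>. (X n \<omega>)\<^sup>2))"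
    using up by (simp add: L_def v_def[abs_def])
qed

end

section \<open>Fejer sums and cosine polynomials\<close>

lemma infsum_finite_support:
  assumes "finite S" "\<And>x. x \<notin> S \<Longrightarrow> f x = 0"
  shows "infsum f UNIV = sum f S"
  using infsum_cong_neutral[of S UNIV f f] assms by (simp add: infsum_finite)

text \<open>This is \<open>n\<close> times the Fejer kernel, in real coordinates. Unlike the
  quotient (1 - cos n t) / (1 - cos t), it has the right value n^2 at t = 0.\<close>

definition fejer_sum :: "nat \<Rightarrow> real \<Rightarrow> real" where
  "fejer_sum n t = (\<Sum>j<n. cos (real j * t))\<^sup>2 + (\<Sum>j<n. sin (real j * t))\<^sup>2"

lemma fejer_sum_nonneg: "fejer_sum n t \<ge> 0"
  by (simp add: fejer_sum_def)

lemma fejer_sum_0: "fejer_sum n 0 = (real n)\<^sup>2"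
  by (simp add: fejer_sum_def)

lemma continuous_on_fejer_sum [continuous_intros]: "continuous_on A (fejer_sum n)"
  unfolding fejer_sum_def by (intro continuous_intros)

text \<open>Take squared moduli in 1 - z^n = (1 - z) (1 + ... + z^(n-1)) at z =
  \<open>cis t\<close>, and use |1 - cis u|^2 = 2 (1 - cos u).\<close>

lemma one_minus_cos_mult_fejer_sum: "(1 - cos t) * fejer_sum n t = 1 - cos (real n * t)"
proof -
  have n: "(norm (1 - cis u))\<^sup>2 = 2 * (1 - cos u)" for u
  proof -
    have "(norm (1 - cis u))\<^sup>2 = (1 - cos u)\<^sup>2 + (sin u)\<^sup>2" by (simp add: cmod_power2)
    also have "\<dots> = 2 * (1 - cos u)" using sin_cos_squared_add[of u] by (simp add: power2_diff)
    finally show ?thesis .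
  qed
  have "(\<Sum>j<n. cis (real j * t)) = (\<Sum>j<n. cis t ^ j)"
    by (simp add: Complex.DeMoivre)
  then have "1 - cis (real n * t) = (1 - cis t) * (\<Sum>j<n. cis (real j * t))"
    using one_diff_power_eq[of "cis t" n] by (simp add: Complex.DeMoivre)
  then have "(norm (1 - cis (real n * t)))\<^sup>2 = (norm (1 - cis t))\<^sup>2 * (norm (\<Sum>j<n. cis (real j * t)))\<^sup>2"
    by (simp add: norm_mult power_mult_distrib)
  moreover have "(norm (\<Sum>j<n. cis (real j * t)))\<^sup>2 = fejer_sum n t"
    by (simp add: cmod_power2 fejer_sum_def)
  ultimately show ?thesis unfolding n by (simp add: algebra_simps)
qed

lemma fejer_sum_cos_expansion:
  "fejer_sum n t = (\<Sum>i<n. \<Sum>j<n. cos (real_of_int (int i - int j) * t))"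
  by (simp add: fejer_sum_def power2_eq_square sum_product sum.distrib[symmetric] cos_diff left_diff_distrib)

lemma cos_eq_1_iff_pi: 
  assumes "t \<in> {-pi..pi}" shows "cos t = 1 \<longleftrightarrow> t = 0"
proof
  assume "cos t = 1"
  then obtain n :: int where n: "t = real_of_int n * 2 * pi" by (auto simp: cos_one_2pi_int)
  have "\<bar>t\<bar> \<le> pi" using assms by auto
  then have "\<bar>real_of_int n * 2 * pi\<bar> \<le> pi" unfolding n .
  then have "\<bar>real_of_int n\<bar> * 2 \<le> 1" by (simp add: abs_mult)
  then have "n = 0" by linarith
  then show "t = 0" using n by simp
qed simp

text \<open>The potential kernel will be an integral of these sums against 1 / R, so this identity
  turns its second difference into a Fourier coefficient. Away from 0 it follows by cancelling 1 -
  cos t; at 0 it is the second difference of the squares.\<close>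

lemma fejer_sum_second_difference:
  assumes "t \<in> {-pi..pi}"
  shows "fejer_sum (nat \<bar>x - 1\<bar>) t + fejer_sum (nat \<bar>x + 1\<bar>) t - 2 * fejer_sum (nat \<bar>x\<bar>) t
    = 2 * cos (real_of_int x * t)"
proof (cases "t = 0")
  case True
  have "(real (nat \<bar>y\<bar>))\<^sup>2 = (real_of_int y)\<^sup>2" for y :: int by (simp add: power2_eq_square)
  then show ?thesis using True by (simp add: fejer_sum_0 power2_eq_square algebra_simps)
next
  case False
  have F: "(1 - cos t) * fejer_sum (nat \<bar>y\<bar>) t = 1 - cos (real_of_int y * t)" for y :: int
  proof -
    have "cos (real (nat \<bar>y\<bar>) * t) = cos (real_of_int y * t)"
      by (cases "y \<ge> 0") (simp_all add: abs_if)
    then show ?thesis by (simp add: one_minus_cos_mult_fejer_sum)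
  qed
  have c: "cos (real_of_int (x - 1) * t) + cos (real_of_int (x + 1) * t) = 2 * cos (real_of_int x * t) * cos t"
    by (simp add: left_diff_distrib distrib_right cos_add cos_diff)
  have "(1 - cos t) * (fejer_sum (nat \<bar>x - 1\<bar>) t + fejer_sum (nat \<bar>x + 1\<bar>) t - 2 * fejer_sum (nat \<bar>x\<bar>) t)
    = (1 - cos t) * (2 * cos (real_of_int x * t))"
    using F[of "x - 1"] F[of "x + 1"] F[of x] c by (simp add: algebra_simps)
  moreover have "1 - cos t \<noteq> 0" using False cos_eq_1_iff_pi[OF assms] by simp
  ultimately show ?thesis by simp
qed

section \<open>Orthogonality of cosines, and Fourier coefficients of reciprocals of cosine
  polynomials\<close>

lemma has_integral_cos_int:
  "((\<lambda>t. cos (real_of_int n * t)) has_integral (if n = 0 then 2 * pi else 0)) {-pi..pi}"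
proof (cases "n = 0")
  case True
  then show ?thesis using has_integral_const_real[of "1::real" "-pi" pi] by simp
next
  case False
  have "((\<lambda>t. cos (real_of_int n * t)) has_integral sin (real_of_int n * pi) / n - sin (real_of_int n * (-pi)) / n) {-pi..pi}"
    by (rule fundamental_theorem_of_calculus)
      (use False in \<open>auto intro!: derivative_eq_intros simp: has_real_derivative_iff_has_vector_derivative[symmetric]\<close>)
  then show ?thesis using False by (simp add: sin_int_times_real mult.commute)
qed

text \<open>The symmetric range admits the frequencies i - j of the Fejer expansion as they stand.
  As cos is even, the coefficients are not unique; only the bound \<open>N\<close> on the
  frequencies matters.\<close>

definition cos_poly :: "int \<Rightarrow> (real \<Rightarrow> real) \<Rightarrow> bool" where
  "cos_poly N f \<longleftrightarrow> (\<exists>r. \<forall>t. f t = (\<Sum>j\<in>{-N..N}. r j * cos (real_of_int j * t)))"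

lemma cos_poly_cos: "\<bar>j\<bar> \<le> N \<Longrightarrow> cos_poly N (\<lambda>t. c * cos (real_of_int j * t))"
  unfolding cos_poly_def
  by (rule exI[of _ "\<lambda>i. if i = j then c else 0"]) (auto simp: if_distrib[of "\<lambda>x. x * _"] cong: if_cong)

lemma cos_poly_add:
  assumes "cos_poly N f" "cos_poly N g" shows "cos_poly N (\<lambda>t. f t + g t)"
proof -
  obtain r s where "\<forall>t. f t = (\<Sum>j\<in>{-N..N}. r j * cos (real_of_int j * t))" 
     "\<forall>t. g t = (\<Sum>j\<in>{-N..N}. s j * cos (real_of_int j * t))"
    using assms by (auto simp: cos_poly_def)
  then show ?thesis unfolding cos_poly_def
    by (intro exI[of _ "\<lambda>j. r j + s j"]) (simp add: sum.distrib distrib_right)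
qed

lemma cos_poly_scale:
  assumes "cos_poly N f" shows "cos_poly N (\<lambda>t. c * f t)"
proof -
  obtain r where "\<forall>t. f t = (\<Sum>j\<in>{-N..N}. r j * cos (real_of_int j * t))" 
    using assms by (auto simp: cos_poly_def)
  then show ?thesis unfolding cos_poly_def
    by (intro exI[of _ "\<lambda>j. c * r j"]) (simp add: sum_distrib_left mult.assoc)
qed

lemma cos_poly_sum:
  assumes "\<And>i. i \<in> I \<Longrightarrow> cos_poly N (f i)" shows "cos_poly N (\<lambda>t. \<Sum>i\<in>I. f i t)"
proof -
  have "cos_poly N (\<lambda>t. 0)" unfolding cos_poly_def by (rule exI[of _ "\<lambda>_. 0"]) simp
  then show ?thesis using assms
    by (induction I rule: infinite_finite_induct) (auto intro: cos_poly_add)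
qed

lemma cos_poly_fejer_sum: "int n \<le> N \<Longrightarrow> cos_poly N (fejer_sum n)"
  unfolding fejer_sum_cos_expansion[abs_def]
  by (intro cos_poly_sum cos_poly_cos[where c=1, simplified]) auto

lemma cos_poly_continuous: "cos_poly N f \<Longrightarrow> continuous_on A f"
  by (auto simp: cos_poly_def fun_eq_iff[symmetric] intro!: continuous_intros)

lemma cos_mult_cos: "cos (real_of_int j * t) * cos (real_of_int x * t)
   = (cos (real_of_int (x - j) * t) + cos (real_of_int (x + j) * t)) / 2"
  by (simp add: left_diff_distrib distrib_right cos_add cos_diff)

text \<open>The induction hands one factor \<open>Q\<close> over to the cosine. By the product
  formula this moves the frequency by at most \<open>N\<close>, exactly what the hypothesis gives up
  when \<open>m\<close> drops by one.\<close>

lemma cos_poly_power_orthogonal: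
  assumes Q: "cos_poly N Q" and x: "\<bar>x\<bar> > int m * N"
  shows "((\<lambda>t. Q t ^ m * cos (real_of_int x * t)) has_integral 0) {-pi..pi}"
  using x
proof (induction m arbitrary: x)
  case 0
  then show ?case using has_integral_cos_int[of x] by simp
next
  case (Suc m)
  obtain r where r: "\<And>t. Q t = (\<Sum>j\<in>{-N..N}. r j * cos (real_of_int j * t))"
    using Q by (auto simp: cos_poly_def)
  have eq: "Q t ^ Suc m * cos (real_of_int x * t) =
     (\<Sum>j\<in>{-N..N}. r j / 2 * (Q t ^ m * cos (real_of_int (x - j) * t) + Q t ^ m * cos (real_of_int (x + j) * t)))" for t
  proof -
    have "Q t * cos (real_of_int x * t) = (\<Sum>j\<in>{-N..N}. r j * (cos (real_of_int j * t) * cos (real_of_int x * t)))"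
      by (simp add: r[of t] sum_distrib_right mult.assoc)
    then have "Q t ^ Suc m * cos (real_of_int x * t) = Q t ^ m * (\<Sum>j\<in>{-N..N}. r j * (cos (real_of_int j * t) * cos (real_of_int x * t)))"
      by (simp only: power_Suc2 mult.assoc)
    also have "\<dots> = (\<Sum>j\<in>{-N..N}. r j / 2 * (Q t ^ m * cos (real_of_int (x - j) * t) + Q t ^ m * cos (real_of_int (x + j) * t)))"
      unfolding cos_mult_cos sum_distrib_left by (intro sum.cong) (auto simp: algebra_simps)
    finally show ?thesis .
  qed
  have "((\<lambda>t. \<Sum>j\<in>{-N..N}. r j / 2 * (Q t ^ m * cos (real_of_int (x - j) * t) + Q t ^ m * cos (real_of_int (x + j) * t)))
    has_integral (\<Sum>j\<in>{-N..N}. r j / 2 * (0 + 0))) {-pi..pi}"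
  proof (intro has_integral_sum has_integral_mult_right has_integral_add Suc.IH)
    fix j assume j: "j \<in> {-N..N}"
    have "\<bar>x\<bar> > int m * N + N" using Suc.prems by (simp add: algebra_simps)
    then show "\<bar>x - j\<bar> > int m * N" "\<bar>x + j\<bar> > int m * N" using j by auto
  qed simp
  then show ?case by (simp only: eq) simp
qed

text \<open>With L the maximum of R and Q = 1 - R / L, which has values in [0, 1), expand 1 / R as
  (1 / L) times the geometric series in Q.  The first m terms have no Fourier coefficient beyond frequency
  m N, so the coefficient at x is controlled by a tail starting at about |x| / N.\<close>
lemma cos_poly_reciprocal_decay:
  assumes R: "cos_poly N R" and pos: "\<And>t. t \<in> {-pi..pi} \<Longrightarrow> R t > 0"
  obtains A c where "A > 0" "c > 0" 
    "\<And>x. \<bar>integral {-pi..pi} (\<lambda>t. cos (real_of_int x * t) / R t)\<bar> \<le> A * exp (- c * real_of_int \<bar>x\<bar>)"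
proof -
  have cont: "continuous_on {-pi..pi} R" using R by (rule cos_poly_continuous)
  have ne: "{-pi..pi} \<noteq> {}" by simp
  obtain t0 where t0: "t0 \<in> {-pi..pi}" "\<And>t. t \<in> {-pi..pi} \<Longrightarrow> R t0 \<le> R t"
    using continuous_attains_inf[OF compact_Icc ne cont] by blast
  obtain t1 where t1: "t1 \<in> {-pi..pi}" "\<And>t. t \<in> {-pi..pi} \<Longrightarrow> R t \<le> R t1"
    using continuous_attains_sup[OF compact_Icc ne cont] by blast
  define L where "L = R t1"
  define r0 where "r0 = R t0"
  have L: "L > 0" and r0: "r0 > 0" using pos t0 t1 by (auto simp: L_def r0_def)
  \<comment> \<open>The maximum of \<open>Q\<close> is 1 - r0 / L, which is 0 when \<open>R\<close>
    is constant. The lower bound 1/2 keeps \<open>ln \<rho>\<close> and the division by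
    \<open>\<rho>\<close> meaningful.\<close>
  define \<rho> where "\<rho> = max (1/2) (1 - r0 / L)"
  have \<rho>: "0 < \<rho>" "\<rho> < 1" using L r0 by (auto simp: \<rho>_def)
  define Q where "Q t = 1 - R t / L" for t
  define N' where "N' = max N 1"
  have N': "N' \<ge> 1" by (simp add: N'_def)
  have "cos_poly N' Q"
  proof -
    have "cos_poly N R \<Longrightarrow> cos_poly N' R"
    proof -
      assume "cos_poly N R"
      then obtain r where r: "\<And>t. R t = (\<Sum>j\<in>{-N..N}. r j * cos (real_of_int j * t))"
        by (auto simp: cos_poly_def)
      have "cos_poly N' (\<lambda>t. \<Sum>j\<in>{-N..N}. r j * cos (real_of_int j * t))"
        by (intro cos_poly_sum cos_poly_cos) (auto simp: N'_def)
      then show ?thesis by (simp add: r[symmetric])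
    qed
    from cos_poly_add[OF cos_poly_cos[of 0 N' 1] cos_poly_scale[OF this[OF R], of "-1/L"]]
    show ?thesis using N' by (simp add: Q_def[abs_def])
  qed
  note Q = this
  have Qb: "0 \<le> Q t" "Q t \<le> \<rho>" if "t \<in> {-pi..pi}" for t
    using t0(2)[OF that] t1(2)[OF that] L by (auto simp: Q_def \<rho>_def L_def[symmetric] r0_def[symmetric] divide_right_mono le_max_iff_disj)
  have Qc: "continuous_on {-pi..pi} Q" using Q by (rule cos_poly_continuous)
  \<comment> \<open>For \<open>k < m x\<close> even (k + 1) N' is at most |x|, which gives the
    strict inequality k N' < |x| that orthogonality requires.\<close>
  define m where "m x = nat (\<bar>x\<bar> div N')" for x :: int
  have bound: "\<bar>integral {-pi..pi} (\<lambda>t. cos (real_of_int x * t) / R t)\<bar> \<le> 2 * pi / r0 * \<rho> ^ m x" for x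
  proof -
    have eq: "cos (real_of_int x * t) / R t = (\<Sum>k<m x. 1 / L * (Q t ^ k * cos (real_of_int x * t))) + Q t ^ m x * cos (real_of_int x * t) / R t"
      if "t \<in> {-pi..pi}" for t
    proof -
      have RQ: "R t = L * (1 - Q t)" using L by (simp add: Q_def)
      have "1 - Q t \<noteq> 0" using pos[OF that] RQ by auto
      moreover have "(1 - Q t) * (\<Sum>k<m x. Q t ^ k) = 1 - Q t ^ m x" by (rule one_diff_power_eq[symmetric])
      ultimately have "1 = (1 - Q t) * (\<Sum>k<m x. Q t ^ k) + Q t ^ m x" by simp
      then have "1 / R t = (\<Sum>k<m x. Q t ^ k) / L + Q t ^ m x / R t"
        unfolding RQ using L \<open>1 - Q t \<noteq> 0\<close> by (simp add: divide_simps) (simp add: algebra_simps)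
      then have "cos (real_of_int x * t) * (1 / R t) = cos (real_of_int x * t) * ((\<Sum>k<m x. Q t ^ k) / L + Q t ^ m x / R t)" by simp
      then show ?thesis
        by (simp add: sum_divide_distrib distrib_left sum_distrib_left mult.commute)
    qed
    have z: "((\<lambda>t. \<Sum>k<m x. 1 / L * (Q t ^ k * cos (real_of_int x * t))) has_integral (\<Sum>k<m x. 1 / L * 0)) {-pi..pi}"
    proof (intro has_integral_sum has_integral_mult_right cos_poly_power_orthogonal[OF Q])
      fix k assume "k \<in> {..<m x}"
      then have "int k < \<bar>x\<bar> div N'" by (simp add: m_def)
      then have "(int k + 1) * N' \<le> \<bar>x\<bar> div N' * N'" using N' by (intro mult_right_mono) auto
      also have "\<dots> \<le> \<bar>x\<bar>" using N' pos_mod_sign[of N' "\<bar>x\<bar>"] by (simp add: minus_mod_eq_div_mult[symmetric])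
      finally have "(int k + 1) * N' \<le> \<bar>x\<bar>" .
      then show "\<bar>x\<bar> > int k * N'" using N' by (simp add: algebra_simps)
    qed simp
    have int2: "(\<lambda>t. Q t ^ m x * cos (real_of_int x * t) / R t) integrable_on {-pi..pi}"
      by (intro integrable_continuous_real continuous_intros Qc cont) (use pos in force)
    have "integral {-pi..pi} (\<lambda>t. cos (real_of_int x * t) / R t) = integral {-pi..pi} (\<lambda>t. (\<Sum>k<m x. 1 / L * (Q t ^ k * cos (real_of_int x * t))) + Q t ^ m x * cos (real_of_int x * t) / R t)"
      by (rule integral_cong) (rule eq)
    also have "\<dots> = integral {-pi..pi} (\<lambda>t. Q t ^ m x * cos (real_of_int x * t) / R t)"
      using integral_unique[OF has_integral_add[OF z integrable_integral[OF int2]]] by simp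
    finally have i: "integral {-pi..pi} (\<lambda>t. cos (real_of_int x * t) / R t) = integral {-pi..pi} (\<lambda>t. Q t ^ m x * cos (real_of_int x * t) / R t)" .
    have "norm (integral {-pi..pi} (\<lambda>t. Q t ^ m x * cos (real_of_int x * t) / R t)) \<le> \<rho> ^ m x / r0 * (pi - (-pi))"
    proof (rule integral_bound)
      show "continuous_on {-pi..pi} (\<lambda>t. Q t ^ m x * cos (real_of_int x * t) / R t)"
        by (intro continuous_intros Qc cont) (use pos in force)
      fix t assume t: "t \<in> {-pi..pi}"
      have "\<bar>Q t ^ m x * cos (real_of_int x * t)\<bar> \<le> \<rho> ^ m x * 1"
        unfolding abs_mult using Qb[OF t] \<rho> by (intro mult_mono) (auto simp: power_abs intro!: power_mono)
      moreover have "R t \<ge> r0" using t0(2)[OF t] by (simp add: r0_def)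
      ultimately show "norm (Q t ^ m x * cos (real_of_int x * t) / R t) \<le> \<rho> ^ m x / r0"
        using r0 \<rho> by (auto simp: abs_divide intro!: frac_le)
    qed simp
    then show ?thesis unfolding i by (simp add: mult.commute)
  qed
  show ?thesis
  \<comment> \<open>Rounding down costs at most one power, as m x is at least |x| / N' - 1. This is
    the source of the extra factor 1 / \<rho> in the constant.\<close>
  proof (rule that[of "2 * pi / r0 / \<rho>" "- ln \<rho> / N'"])
    show "0 < 2 * pi / r0 / \<rho>" using r0 \<rho> by simp
    show "0 < - ln \<rho> / N'" using \<rho> N' by (simp add: divide_neg_pos)
    fix x :: int
    have "\<bar>x\<bar> < (\<bar>x\<bar> div N' + 1) * N'"
      using N' pos_mod_bound[of N' "\<bar>x\<bar>"] minus_mod_eq_div_mult[of "\<bar>x\<bar>" N'] unfolding distrib_right by linarith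
    moreover have "int (m x) = \<bar>x\<bar> div N'" using N' by (simp add: m_def pos_imp_zdiv_nonneg_iff)
    ultimately have "\<bar>x\<bar> < (int (m x) + 1) * N'" by simp
    then have "real_of_int \<bar>x\<bar> < real_of_int ((int (m x) + 1) * N')" by (simp only: of_int_less_iff)
    then have "real_of_int \<bar>x\<bar> < (real (m x) + 1) * real_of_int N'" by simp
    then have "real_of_int \<bar>x\<bar> / N' - 1 \<le> real (m x)" using N' by (simp add: field_simps)
    then have "real (m x) * ln \<rho> \<le> (real_of_int \<bar>x\<bar> / N' - 1) * ln \<rho>"
      using \<rho> by (intro mult_right_mono_neg) auto
    then have "exp (real (m x) * ln \<rho>) \<le> exp ((real_of_int \<bar>x\<bar> / N' - 1) * ln \<rho>)" by simp
    also have "exp ((real_of_int \<bar>x\<bar> / N' - 1) * ln \<rho>) = exp (- (- ln \<rho> / N') * real_of_int \<bar>x\<bar>) / \<rho>"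
      unfolding left_diff_distrib exp_diff using \<rho> by (simp add: mult.commute)
    also have "exp (real (m x) * ln \<rho>) = \<rho> ^ m x" using \<rho> by (simp add: exp_of_nat_mult)
    finally have "\<rho> ^ m x \<le> exp (- (- ln \<rho> / N') * real_of_int \<bar>x\<bar>) / \<rho>" .
    then have "2 * pi / r0 * \<rho> ^ m x \<le> 2 * pi / r0 * (exp (- (- ln \<rho> / N') * real_of_int \<bar>x\<bar>) / \<rho>)"
      using r0 by (intro mult_left_mono) auto
    then show "\<bar>integral {-pi..pi} (\<lambda>t. cos (real_of_int x * t) / R t)\<bar> \<le> 2 * pi / r0 / \<rho> * exp (- (- ln \<rho> / N') * real_of_int \<bar>x\<bar>)"
      using bound[of x] by (simp add: mult.commute)
  qed
qed

lemma has_sum_finite_sum: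
  fixes f :: "'i \<Rightarrow> 'b \<Rightarrow> 'c::{topological_comm_monoid_add}"
  assumes "finite I" "\<And>i. i \<in> I \<Longrightarrow> (f i has_sum s i) A"
  shows "((\<lambda>x. \<Sum>i\<in>I. f i x) has_sum (\<Sum>i\<in>I. s i)) A"
  using assms by (induction I rule: finite_induct) (auto intro: has_sum_add)

lemma exp_abs_summable:
  assumes "c > 0" shows "(\<lambda>x::int. exp (- c * real_of_int \<bar>x\<bar>)) summable_on UNIV"
proof -
  have "summable (\<lambda>n. norm (exp (- c) ^ n))" using assms by simp
  then have nat: "(\<lambda>n::nat. exp (- c * real n)) summable_on UNIV"
    by (intro norm_summable_imp_summable_on) (simp add: exp_of_nat_mult[symmetric] mult.commute)
  have "(\<lambda>x::int. exp (- c * real_of_int \<bar>x\<bar>)) summable_on range int"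
    using nat by (subst summable_on_reindex) (auto simp: comp_def)
  moreover have "(\<lambda>x::int. exp (- c * real_of_int \<bar>x\<bar>)) summable_on range (\<lambda>n. - int n)"
    using nat by (subst summable_on_reindex) (auto simp: comp_def inj_on_def)
  ultimately have "(\<lambda>x::int. exp (- c * real_of_int \<bar>x\<bar>)) summable_on range int \<union> range (\<lambda>n. - int n)"
    by (rule summable_on_union)
  also have "range int \<union> range (\<lambda>n. - int n) = UNIV"
    by (auto intro: int_cases2)
  finally show ?thesis .
qed

section \<open>The symmetrized kernel and its potential\<close>

locale finite_range_walk =
  fixes p :: "int \<Rightarrow> real" and r :: int
  assumes p_nonneg: "p x \<ge> 0"
    and p_support: "\<bar>x\<bar> > r \<Longrightarrow> p x = 0"
    and p_sum_one: "(\<Sum>a\<in>{-r..r}. p a) = 1"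
    and p_strong_span: "int_subgroup_gen {u + x | x. p x > 0} = UNIV"
    and var_pos: "var_p p > 0"
begin

abbreviation (input) S :: "int set" where "S \<equiv> {-r..r}"

lemma p_notin: "x \<notin> S \<Longrightarrow> p x = 0"
  using p_support by auto

text \<open>The characteristic function of the difference of two independent steps, in real form;
  \<open>phi_q_eq\<close> identifies it with \<open>phi_q\<close>.\<close>

definition phi :: "real \<Rightarrow> real" where
  "phi t = (\<Sum>a\<in>S. \<Sum>b\<in>S. p a * p b * cos (real_of_int (a - b) * t))"

text \<open>The quotient (1 - phi t) / (1 - cos t), with its removable singularity at 0 removed.\<close>
definition R :: "real \<Rightarrow> real" where
  "R t = (\<Sum>a\<in>S. \<Sum>b\<in>S. p a * p b * fejer_sum (nat \<bar>a - b\<bar>) t)"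

text \<open>As the squared modulus of the characteristic function of \<open>p\<close>,
  \<open>phi\<close> is nonnegative, so the powers of \<open>phi t\<close> can fail to tend to 0
  only where \<open>phi t = 1\<close>.\<close>

lemma phi_square: "phi t = (\<Sum>a\<in>S. p a * cos (real_of_int a * t))\<^sup>2 + (\<Sum>a\<in>S. p a * sin (real_of_int a * t))\<^sup>2"
proof -
  have "cos (real_of_int (a - b) * t) = cos (real_of_int a * t) * cos (real_of_int b * t) + sin (real_of_int a * t) * sin (real_of_int b * t)" for a b
    by (simp add: left_diff_distrib cos_diff)
  then show ?thesis unfolding phi_def power2_eq_square sum_product sum.distrib[symmetric]
    by (intro sum.cong refl) (simp add: algebra_simps)
qed

lemma pp_sum: "(\<Sum>a\<in>S. \<Sum>b\<in>S. p a * p b) = 1"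
  using p_sum_one by (simp flip: sum_distrib_left)

lemma phi_nonneg: "phi t \<ge> 0"
  by (simp add: phi_square)

lemma one_minus_phi: "1 - phi t = (\<Sum>a\<in>S. \<Sum>b\<in>S. p a * p b * (1 - cos (real_of_int (a - b) * t)))"
proof -
  have "1 - phi t = (\<Sum>a\<in>S. \<Sum>b\<in>S. p a * p b) - phi t" using pp_sum by simp
  then show ?thesis unfolding phi_def by (simp add: sum_subtractf right_diff_distrib)
qed

lemma phi_le_1: "phi t \<le> 1"
proof -
  have "1 - phi t \<ge> 0" unfolding one_minus_phi by (intro sum_nonneg mult_nonneg_nonneg p_nonneg) simp
  then show ?thesis by simp
qed

lemma continuous_on_phi [continuous_intros]: "continuous_on A phi"
  unfolding phi_def by (intro continuous_intros)

lemma continuous_on_R [continuous_intros]: "continuous_on A R"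
  unfolding R_def by (intro continuous_intros continuous_on_fejer_sum)

lemma one_minus_cos_mult_R: "(1 - cos t) * R t = 1 - phi t"
proof -
  have "cos (real (nat \<bar>y\<bar>) * t) = cos (real_of_int y * t)" for y :: int
    by (cases "y \<ge> 0") (simp_all add: abs_if)
  then have "(1 - cos t) * fejer_sum (nat \<bar>a - b\<bar>) t = 1 - cos (real_of_int (a - b) * t)" for a b
    by (simp only: one_minus_cos_mult_fejer_sum)
  then show ?thesis unfolding R_def one_minus_phi sum_distrib_left 
    by (intro sum.cong refl) (simp add: mult.left_commute)
qed

text \<open>At 0 the Fejer sums are squares, so \<open>R 0\<close> is the mean of (a - b)^2 for two
  independent steps. After centering, the mixed term vanishes and two variances remain.\<close>

lemma R_0: "R 0 = 2 * var_p p"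
proof -
  have mean: "mean_p p = (\<Sum>a\<in>S. real_of_int a * p a)"
    unfolding mean_p_def by (rule infsum_finite_support) (auto simp: p_notin)
  have var: "var_p p = (\<Sum>a\<in>S. (real_of_int a - mean_p p)\<^sup>2 * p a)"
    unfolding var_p_def by (rule infsum_finite_support) (auto simp: p_notin)
  define m where "m = mean_p p"
  define c where "c a = real_of_int a - m" for a
  have c0: "(\<Sum>a\<in>S. p a * c a) = 0"
    using p_sum_one mean by (simp add: c_def right_diff_distrib sum_subtractf m_def mult.commute flip: sum_distrib_right)
  have "R 0 = (\<Sum>a\<in>S. \<Sum>b\<in>S. p a * p b * (c a - c b)\<^sup>2)"
    unfolding R_def fejer_sum_0 by (intro sum.cong refl) (simp add: c_def power2_eq_square)
  also have "\<dots> = (\<Sum>a\<in>S. \<Sum>b\<in>S. (p a * (c a)\<^sup>2) * p b) + (\<Sum>a\<in>S. \<Sum>b\<in>S. p a * (p b * (c b)\<^sup>2))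
     - 2 * (\<Sum>a\<in>S. \<Sum>b\<in>S. (p a * c a) * (p b * c b))"
    by (simp add: sum.distrib[symmetric] sum_subtractf[symmetric] sum_distrib_left power2_diff algebra_simps)
  also have "\<dots> = 2 * (\<Sum>a\<in>S. p a * (c a)\<^sup>2)"
    using p_sum_one c0 by (simp flip: sum_distrib_left sum_distrib_right)
  finally show ?thesis by (simp add: var c_def m_def mult.commute)
qed

text \<open>If \<open>phi t = 1\<close>, a vanishing sum of nonnegative terms forces cos ((a - b) t)
  = 1 for all support points a, b, and the span condition then gives cos t = 1. The point t = 0 is
  left to the variance.\<close>

lemma R_pos:
  assumes t: "t \<in> {-pi..pi}" shows "R t > 0"
proof (cases "t = 0")
  case True
  then show ?thesis using R_0 var_pos by simp
next
  case False
  then have c: "1 - cos t > 0" using cos_eq_1_iff_pi[OF t] cos_le_one[of t] by linarith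
  have "phi t \<noteq> 1"
  proof
    assume "phi t = 1"
    then have z: "(\<Sum>a\<in>S. \<Sum>b\<in>S. p a * p b * (1 - cos (real_of_int (a - b) * t))) = 0"
      using one_minus_phi[of t] by simp
    have nn: "p a * p b * (1 - cos (real_of_int (a - b) * t)) \<ge> 0" for a b
      by (intro mult_nonneg_nonneg p_nonneg) simp
    have eq1: "cos (real_of_int (a - b) * t) = 1" if "p a > 0" "p b > 0" for a b
    proof -
      have "a \<in> S" "b \<in> S" using that p_notin by fastforce+
      have "(\<Sum>b\<in>S. p a * p b * (1 - cos (real_of_int (a - b) * t))) = 0"
        by (rule sum_nonneg_0[OF _ _ z \<open>a \<in> S\<close>]) (auto intro!: sum_nonneg nn simp del: of_int_diff)
      from sum_nonneg_0[OF _ nn this \<open>b \<in> S\<close>]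
      have "p a * p b * (1 - cos (real_of_int (a - b) * t)) = 0" by simp
      then show ?thesis using that by simp
    qed
    have "\<exists>b. p b \<noteq> 0"
    proof (rule ccontr)
      assume "\<not> ?thesis"
      then show False using p_sum_one by simp
    qed
    then obtain b where b: "p b > 0" using p_nonneg by (metis less_eq_real_def)
    \<comment> \<open>Only differences of support points are controlled, so the support itself need
      not lie in the subgroup \<open>G\<close>. Its translate by \<open>- b\<close> does, which is
      the span condition with u = - b.\<close>
    define G where "G = {n::int. cos (real_of_int n * t) = 1}"
    have "{- b + x | x. p x > 0} \<subseteq> G"
      using eq1 b by (auto simp: G_def)
    moreover have "0 \<in> G" by (simp add: G_def)
    moreover have "x - y \<in> G" if "x \<in> G" "y \<in> G" for x y
    proof -
      have s: "sin (real_of_int z * t) = 0" if "z \<in> G" for z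
        using that sin_cos_squared_add[of "real_of_int z * t"] by (simp add: G_def)
      show ?thesis using that s[OF that(1)] by (simp add: G_def left_diff_distrib cos_diff)
    qed
    ultimately have "int_subgroup_gen {- b + x | x. p x > 0} \<subseteq> G"
      unfolding int_subgroup_gen_def by (intro Inter_lower) auto
    then have "1 \<in> G" unfolding p_strong_span by auto
    then show False using c by (simp add: G_def)
  qed
  then have "(1 - cos t) * R t > 0" unfolding one_minus_cos_mult_R using phi_le_1[of t] by linarith
  then show ?thesis using c by (simp add: zero_less_mult_iff)
qed

lemma phi_less_1: "t \<in> {-pi..pi} \<Longrightarrow> t \<noteq> 0 \<Longrightarrow> phi t < 1"
  using one_minus_cos_mult_R[of t] R_pos[of t] cos_eq_1_iff_pi[of t] cos_le_one[of t]
  by (metis diff_gt_0_iff_gt less_eq_real_def mult_pos_pos)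

lemma cos_poly_R: "cos_poly (2 * r) R"
  unfolding R_def[abs_def] by (intro cos_poly_sum cos_poly_scale cos_poly_fejer_sum) auto

lemma R_minus: "R (- t) = R t"
  by (simp add: R_def fejer_sum_cos_expansion)

text \<open>Cosines are eigenfunctions of the symmetrized kernel with eigenvalue
  \<open>phi t\<close>: the sine part is antisymmetric under exchanging a and b and cancels.\<close>

lemma sum_translate_cos:
  "(\<Sum>a\<in>S. \<Sum>b\<in>S. p a * p b * cos (real_of_int (x + a - b) * t)) = phi t * cos (real_of_int x * t)"
proof -
  have "(\<Sum>a\<in>S. \<Sum>b\<in>S. p a * p b * sin (real_of_int (a - b) * t)) = (\<Sum>b\<in>S. \<Sum>a\<in>S. p b * p a * sin (real_of_int (a - b) * t))"
    by (subst sum.swap) (simp add: mult.commute)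
  also have "\<dots> = (\<Sum>b\<in>S. \<Sum>a\<in>S. - (p b * p a * sin (real_of_int (b - a) * t)))"
  proof (intro sum.cong refl)
    fix a b :: int
    have "sin (real_of_int (a - b) * t) = - sin (real_of_int (b - a) * t)"
      by (simp add: left_diff_distrib sin_diff)
    then show "p b * p a * sin (real_of_int (a - b) * t) = - (p b * p a * sin (real_of_int (b - a) * t))" by simp
  qed
  also have "\<dots> = - (\<Sum>a\<in>S. \<Sum>b\<in>S. p a * p b * sin (real_of_int (a - b) * t))"
    by (simp add: sum_negf)
  finally have s: "(\<Sum>a\<in>S. \<Sum>b\<in>S. p a * p b * sin (real_of_int (a - b) * t)) = 0" by simp
  have c: "cos (real_of_int (x + a - b) * t) = cos (real_of_int (a - b) * t) * cos (real_of_int x * t) - sin (real_of_int (a - b) * t) * sin (real_of_int x * t)" for a b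
  proof -
    have "real_of_int (x + a - b) * t = real_of_int (a - b) * t + real_of_int x * t" by (simp add: algebra_simps)
    then show ?thesis by (simp only: cos_add)
  qed
  have "(\<Sum>a\<in>S. \<Sum>b\<in>S. p a * p b * cos (real_of_int (x + a - b) * t)) =
    (\<Sum>a\<in>S. \<Sum>b\<in>S. p a * p b * cos (real_of_int (a - b) * t)) * cos (real_of_int x * t)
    - (\<Sum>a\<in>S. \<Sum>b\<in>S. p a * p b * sin (real_of_int (a - b) * t)) * sin (real_of_int x * t)"
    unfolding c sum_distrib_right sum_subtractf[symmetric] by (simp only: right_diff_distrib mult.assoc)
  then show ?thesis unfolding s by (simp add: phi_def)
qed

section \<open>The k-step kernels: finite recursions, Fourier inversion and the potential
  kernel\<close>

lemma pk_Suc: "pk p (Suc k) x y = (\<Sum>a\<in>S. p a * pk p k (x + a) y)"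
proof -
  have "pk p (Suc k) x y = (\<Sum>z\<in>{x-r..x+r}. p (z - x) * pk p k z y)"
    unfolding pk.simps by (rule infsum_finite_support) (auto intro!: p_support)
  also have "\<dots> = (\<Sum>a\<in>S. p a * pk p k (x + a) y)"
    by (rule sum.reindex_bij_witness[of _ "\<lambda>a. x + a" "\<lambda>z. z - x"]) auto
  finally show ?thesis .
qed

lemma pk_support: "\<bar>y - x\<bar> > int k * r \<Longrightarrow> pk p k x y = 0"
proof (induction k arbitrary: x)
  case (Suc k)
  have "pk p k (x + a) y = 0" if "a \<in> S" for a
  proof (rule Suc.IH)
    have "\<bar>y - x\<bar> > int k * r + r" using Suc.prems by (simp add: algebra_simps)
    then show "\<bar>y - (x + a)\<bar> > int k * r" using that by auto
  qed
  then show ?case unfolding pk_Suc by (intro sum.neutral) simp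
qed simp

lemma qk_Suc: "qk p (Suc k) x y = (\<Sum>a\<in>S. \<Sum>b\<in>S. p a * p b * qk p k (x + a - b) y)"
proof -
  have q: "qker p x z = (\<Sum>b\<in>S. p b * p (z + b - x))" for z
    unfolding qker_def by (rule infsum_finite_support) (auto simp: p_notin)
  have "qk p (Suc k) x y = (\<Sum>z\<in>{x-2*r..x+2*r}. qker p x z * qk p k z y)"
    unfolding qk.simps
  proof (rule infsum_finite_support)
    fix z assume z: "z \<notin> {x-2*r..x+2*r}"
    have "p (z + b - x) = 0" if "b \<in> S" for b
      using z that by (intro p_support) auto
    then have "qker p x z = 0" unfolding q by (intro sum.neutral) simp
    then show "qker p x z * qk p k z y = 0" by simp
  qed simp
  also have "\<dots> = (\<Sum>b\<in>S. \<Sum>z\<in>{x-2*r..x+2*r}. p b * p (z + b - x) * qk p k z y)"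
    unfolding q sum_distrib_right by (rule sum.swap)
  also have "\<dots> = (\<Sum>b\<in>S. \<Sum>a\<in>S. p a * p b * qk p k (x + a - b) y)"
  proof (rule sum.cong[OF refl])
    fix b assume b: "b \<in> S"
    have "(\<Sum>z\<in>{x-2*r..x+2*r}. p b * p (z + b - x) * qk p k z y) = (\<Sum>z\<in>{x-r-b..x+r-b}. p b * p (z + b - x) * qk p k z y)"
      by (rule sum.mono_neutral_right) (use b in \<open>auto intro!: p_support\<close>)
    also have "\<dots> = (\<Sum>a\<in>S. p a * p b * qk p k (x + a - b) y)"
      by (rule sum.reindex_bij_witness[of _ "\<lambda>a. x + a - b" "\<lambda>z. z + b - x"]) auto
    finally show "(\<Sum>z\<in>{x-2*r..x+2*r}. p b * p (z + b - x) * qk p k z y) = (\<Sum>a\<in>S. p a * p b * qk p k (x + a - b) y)" .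
  qed
  also have "\<dots> = (\<Sum>a\<in>S. \<Sum>b\<in>S. p a * p b * qk p k (x + a - b) y)" by (rule sum.swap)
  finally show ?thesis .
qed

text \<open>Two independent \<open>p\<close>-walks from \<open>x\<close> and \<open>y\<close> meet
  after \<open>k\<close> steps exactly when their difference, a q-walk from \<open>x - y\<close>, is
  at 0. A meeting point is reachable from both starts, so \<open>Z\<close> has to contain only such
  sites.\<close>

lemma sum_pk_mult_pk:
  assumes "finite Z" "\<And>z. \<bar>z - x\<bar> \<le> int k * r \<Longrightarrow> \<bar>z - y\<bar> \<le> int k * r \<Longrightarrow> z \<in> Z"
  shows "(\<Sum>z\<in>Z. pk p k x z * pk p k y z) = qk p k (x - y) 0"
proof -
  \<comment> \<open>The set \<open>W\<close> stays fixed in the induction while both starting points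
    move by at most \<open>r\<close>; the smaller \<open>k\<close> pays for this.\<close>
  have large: "(\<Sum>z\<in>W. pk p k x z * pk p k y z) = qk p k (x - y) 0"
    if "finite W" "{x - int k * r..x + int k * r} \<union> {y - int k * r..y + int k * r} \<subseteq> W" for x y W
    using that
  proof (induction k arbitrary: x y W)
    case 0
    have "(\<Sum>z\<in>W. pk p 0 x z * pk p 0 y z) = (\<Sum>z\<in>W. if x = z then (if y = z then 1 else 0) else 0)"
      by (rule sum.cong) auto
    also have "\<dots> = qk p 0 (x - y) 0" using 0 by (simp add: sum.delta)
    finally show ?case .
  next
    case (Suc k)
    have "(\<Sum>z\<in>W. pk p (Suc k) x z * pk p (Suc k) y z) =
      (\<Sum>z\<in>W. \<Sum>a\<in>S. \<Sum>b\<in>S. p a * p b * (pk p k (x + a) z * pk p k (y + b) z))"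
      unfolding pk_Suc sum_product by (simp add: mult_ac)
    also have "\<dots> = (\<Sum>a\<in>S. \<Sum>z\<in>W. \<Sum>b\<in>S. p a * p b * (pk p k (x + a) z * pk p k (y + b) z))"
      by (rule sum.swap)
    also have "\<dots> = (\<Sum>a\<in>S. \<Sum>b\<in>S. p a * p b * (\<Sum>z\<in>W. pk p k (x + a) z * pk p k (y + b) z))"
      unfolding sum_distrib_left by (intro sum.cong refl sum.swap)
    also have "\<dots> = (\<Sum>a\<in>S. \<Sum>b\<in>S. p a * p b * qk p k (x + a - (y + b)) 0)"
    proof (intro sum.cong refl arg_cong2[where f="(*)"] Suc.IH Suc.prems(1))
      fix a b assume ab: "a \<in> S" "b \<in> S"
      have "{x - (int k * r + r)..x + (int k * r + r)} \<union> {y - (int k * r + r)..y + (int k * r + r)} \<subseteq> W"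
        using Suc.prems(2) by (simp add: algebra_simps)
      moreover have "{x + a - int k * r..x + a + int k * r} \<subseteq> {x - (int k * r + r)..x + (int k * r + r)}"
        "{y + b - int k * r..y + b + int k * r} \<subseteq> {y - (int k * r + r)..y + (int k * r + r)}"
        using ab by auto
      ultimately show "{x + a - int k * r..x + a + int k * r} \<union> {y + b - int k * r..y + b + int k * r} \<subseteq> W" by blast
    qed
    also have "\<dots> = qk p (Suc k) (x - y) 0" unfolding qk_Suc by (simp add: algebra_simps)
    finally show ?case .
  qed
  define W where "W = Z \<union> {x - int k * r..x + int k * r} \<union> {y - int k * r..y + int k * r}"
  have "(\<Sum>z\<in>Z. pk p k x z * pk p k y z) = (\<Sum>z\<in>W. pk p k x z * pk p k y z)"
  proof (rule sum.mono_neutral_left)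
    show "\<forall>z\<in>W - Z. pk p k x z * pk p k y z = 0"
    proof
      fix z assume "z \<in> W - Z"
      then have "\<bar>z - x\<bar> > int k * r \<or> \<bar>z - y\<bar> > int k * r" using assms(2)[of z] by (meson DiffD2 not_le)
      then show "pk p k x z * pk p k y z = 0" using pk_support by auto
    qed
  qed (auto simp: W_def assms)
  also have "\<dots> = qk p k (x - y) 0" by (rule large) (auto simp: W_def assms)
  finally show ?thesis .
qed

text \<open>The inversion formula. One more step of the kernel multiplies the integrand by
  \<open>phi\<close>, because of the eigenfunction identity.\<close>

lemma qk_fourier: "qk p k x 0 = 1 / (2 * pi) * integral {-pi..pi} (\<lambda>t. phi t ^ k * cos (real_of_int x * t))"
proof (induction k arbitrary: x)
  case 0
  then show ?case using integral_unique[OF has_integral_cos_int[of x]] by simp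
next
  case (Suc k)
  have i: "(\<lambda>t. phi t ^ k * cos (real_of_int y * t)) integrable_on {-pi..pi}" for y :: int
    by (intro integrable_continuous_real continuous_intros)
  have "phi t ^ Suc k * cos (real_of_int x * t) = (\<Sum>a\<in>S. \<Sum>b\<in>S. p a * p b * (phi t ^ k * cos (real_of_int (x + a - b) * t)))" for t
  proof -
    have "phi t ^ Suc k * cos (real_of_int x * t) = phi t ^ k * (phi t * cos (real_of_int x * t))" by (simp add: mult_ac)
    then show ?thesis unfolding sum_translate_cos[symmetric] sum_distrib_left
      by (simp only: mult.left_commute)
  qed
  then have I: "integral {-pi..pi} (\<lambda>t. phi t ^ Suc k * cos (real_of_int x * t)) =
    (\<Sum>a\<in>S. \<Sum>b\<in>S. p a * p b * integral {-pi..pi} (\<lambda>t. phi t ^ k * cos (real_of_int (x + a - b) * t)))"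
    by (simp only:) (intro integral_unique has_integral_sum has_integral_mult_right integrable_integral i finite_atLeastAtMost_int)
  show ?case unfolding qk_Suc Suc.IH I sum_distrib_left by (intro sum.cong refl) simp
qed

text \<open>The remainder of the geometric series in the next lemma. The powers of
  \<open>phi\<close> tend to 0 except at t = 0, where \<open>phi\<close> is 1, and this point is
  negligible.\<close>

lemma phi_power_fejer_integral_tendsto:
  "(\<lambda>n. integral {-pi..pi} (\<lambda>t. phi t ^ n * (fejer_sum m t / R t))) \<longlonglongrightarrow> 0"
proof -
  have ci: "continuous_on {-pi..pi} (\<lambda>t. fejer_sum m t / R t)"
    by (intro continuous_intros) (use R_pos in force)
  have "(\<lambda>n. integral {-pi..pi} (\<lambda>t. phi t ^ n * (fejer_sum m t / R t))) \<longlonglongrightarrow>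
     integral {-pi..pi} (\<lambda>t. if t = 0 then fejer_sum m t / R t else 0)"
  proof (rule dominated_convergence(2)[where h = "\<lambda>t. fejer_sum m t / R t"])
    show "(\<lambda>t. phi t ^ n * (fejer_sum m t / R t)) integrable_on {-pi..pi}" for n
      by (intro integrable_continuous_real continuous_intros ci)
    show "(\<lambda>t. fejer_sum m t / R t) integrable_on {-pi..pi}"
      by (intro integrable_continuous_real ci)
    fix n t assume t: "t \<in> {-pi..pi}"
    have "0 \<le> fejer_sum m t / R t" using R_pos[OF t] fejer_sum_nonneg[of m t] by simp
    moreover have "\<bar>phi t ^ n\<bar> \<le> 1" using phi_nonneg phi_le_1 by (simp add: power_abs power_le_one)
    ultimately show "norm (phi t ^ n * (fejer_sum m t / R t)) \<le> fejer_sum m t / R t"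
      unfolding real_norm_def abs_mult by (metis abs_of_nonneg mult_left_le_one_le abs_ge_zero)
  next
    fix t assume t: "t \<in> {-pi..pi}"
    show "(\<lambda>n. phi t ^ n * (fejer_sum m t / R t)) \<longlonglongrightarrow> (if t = 0 then fejer_sum m t / R t else 0)"
    proof (cases "t = 0")
      case True
      have "phi 0 = 1" using one_minus_cos_mult_R[of 0] by simp
      then show ?thesis using True by simp
    next
      case False
      then have "(\<lambda>n. phi t ^ n) \<longlonglongrightarrow> 0" using phi_less_1[OF t] phi_nonneg by (intro LIMSEQ_power_zero) simp
      from tendsto_mult_left_zero[OF this, of "fejer_sum m t / R t"] show ?thesis using False by simp
    qed
  qed
  also have "integral {-pi..pi} (\<lambda>t. if t = 0 then fejer_sum m t / R t else 0) = integral {-pi..pi} (\<lambda>t. 0)"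
    by (rule integral_spike[of "{0}"]) auto
  finally show ?thesis by simp
qed

text \<open>Sum the geometric series under the integral. Both 1 - phi and 1 - cos x t carry the
  factor 1 - cos t, and the computation divides only by \<open>R\<close>, so the formula for the
  partial sums also holds at t = 0.\<close>

lemma qk_difference_sums:
  "(\<lambda>k. qk p k 0 0 - qk p k x 0) sums (1 / (2 * pi) * integral {-pi..pi} (\<lambda>t. fejer_sum (nat \<bar>x\<bar>) t / R t))"
proof -
  define F where "F = fejer_sum (nat \<bar>x\<bar>)"
  have ci: "continuous_on {-pi..pi} (\<lambda>t. F t / R t)"
    unfolding F_def by (intro continuous_intros) (use R_pos in force)
  have i1: "(\<lambda>t. phi t ^ k * cos (real_of_int y * t)) integrable_on {-pi..pi}" for y :: int and k
    by (intro integrable_continuous_real continuous_intros)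
  have i2: "(\<lambda>t. phi t ^ n * (F t / R t)) integrable_on {-pi..pi}" for n
    by (intro integrable_continuous_real continuous_intros ci)
  have cosx: "1 - cos (real_of_int x * t) = (1 - cos t) * F t" for t
  proof -
    have "cos (real (nat \<bar>x\<bar>) * t) = cos (real_of_int x * t)" by (cases "x \<ge> 0") (simp_all add: abs_if)
    then show ?thesis unfolding F_def by (simp only: one_minus_cos_mult_fejer_sum)
  qed
  have "(\<Sum>k<n. qk p k 0 0 - qk p k x 0) =
     1 / (2 * pi) * (integral {-pi..pi} (\<lambda>t. F t / R t) - integral {-pi..pi} (\<lambda>t. phi t ^ n * (F t / R t)))" for n
  proof -
    have "(\<Sum>k<n. qk p k 0 0 - qk p k x 0) = 1 / (2 * pi) * (\<Sum>k<n. integral {-pi..pi} (\<lambda>t. phi t ^ k - phi t ^ k * cos (real_of_int x * t)))"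
      unfolding qk_fourier sum_distrib_left right_diff_distrib[symmetric] 
      using integral_diff[OF i1[of _ 0] i1[of _ x]] by simp
    also have "(\<Sum>k<n. integral {-pi..pi} (\<lambda>t. phi t ^ k - phi t ^ k * cos (real_of_int x * t)))
       = integral {-pi..pi} (\<lambda>t. \<Sum>k<n. phi t ^ k - phi t ^ k * cos (real_of_int x * t))"
      by (rule integral_sum[symmetric]) (auto intro!: integrable_continuous_real continuous_intros)
    also have "\<dots> = integral {-pi..pi} (\<lambda>t. F t / R t - phi t ^ n * (F t / R t))"
    proof (rule integral_cong)
      fix t assume t: "t \<in> {-pi..pi}"
      have "(\<Sum>k<n. phi t ^ k - phi t ^ k * cos (real_of_int x * t)) = (\<Sum>k<n. phi t ^ k) * (1 - cos (real_of_int x * t))"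
        by (simp add: sum_subtractf sum_distrib_right right_diff_distrib)
      also have "\<dots> = (\<Sum>k<n. phi t ^ k) * ((1 - cos t) * R t) * (F t / R t)"
        using R_pos[OF t] by (simp add: cosx)
      also have "\<dots> = (1 - phi t ^ n) * (F t / R t)"
        unfolding one_minus_cos_mult_R one_diff_power_eq[of "phi t" n] by (simp add: mult_ac)
      finally show "(\<Sum>k<n. phi t ^ k - phi t ^ k * cos (real_of_int x * t)) = F t / R t - phi t ^ n * (F t / R t)"
        by (simp only: left_diff_distrib mult_1)
    qed
    also have "\<dots> = integral {-pi..pi} (\<lambda>t. F t / R t) - integral {-pi..pi} (\<lambda>t. phi t ^ n * (F t / R t))"
      by (rule integral_diff) (use i2[of 0] i2[of n] in auto)
    finally show ?thesis .
  qed
  then show ?thesis unfolding sums_def F_def[symmetric]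
    using tendsto_mult[OF tendsto_const[of "1 / (2 * pi)"] tendsto_diff[OF tendsto_const phi_power_fejer_integral_tendsto[of "nat \<bar>x\<bar>"]]]
    by (simp add: F_def[symmetric])
qed

text \<open>The covariance for unit noise variance. The prefactor is 1 / pi rather than 1 / (2 pi)
  because the second difference of the Fejer sums produces a factor 2.\<close>

definition G :: "int \<Rightarrow> real" where
  "G x = 1 / pi * integral {-pi..pi} (\<lambda>t. cos (real_of_int x * t) / R t)"

lemma pot_second_difference: "pot p (x - 1) + pot p (x + 1) - 2 * pot p x = G x"
proof -
  have pot: "pot p y = 1 / (2 * pi) * integral {-pi..pi} (\<lambda>t. fejer_sum (nat \<bar>y\<bar>) t / R t)" for y
    unfolding pot_def using qk_difference_sums[of y] by (rule sums_unique[symmetric])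
  have i: "(\<lambda>t. fejer_sum m t / R t) integrable_on {-pi..pi}" for m
    by (intro integrable_continuous_real continuous_intros) (use R_pos in force)
  have "integral {-pi..pi} (\<lambda>t. fejer_sum (nat \<bar>x - 1\<bar>) t / R t) + integral {-pi..pi} (\<lambda>t. fejer_sum (nat \<bar>x + 1\<bar>) t / R t)
      - 2 * integral {-pi..pi} (\<lambda>t. fejer_sum (nat \<bar>x\<bar>) t / R t) = 
    integral {-pi..pi} (\<lambda>t. fejer_sum (nat \<bar>x - 1\<bar>) t / R t + fejer_sum (nat \<bar>x + 1\<bar>) t / R t - 2 * (fejer_sum (nat \<bar>x\<bar>) t / R t))"
    by (intro integral_unique[symmetric] has_integral_diff has_integral_add has_integral_mult_right integrable_integral i)
  also have "\<dots> = integral {-pi..pi} (\<lambda>t. 2 * (cos (real_of_int x * t) / R t))"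
  proof (rule integral_cong)
    fix t assume "t \<in> {-pi..pi}"
    from fejer_sum_second_difference[OF this, of x]
    show "fejer_sum (nat \<bar>x - 1\<bar>) t / R t + fejer_sum (nat \<bar>x + 1\<bar>) t / R t - 2 * (fejer_sum (nat \<bar>x\<bar>) t / R t) = 2 * (cos (real_of_int x * t) / R t)"
      by (simp add: add_divide_distrib[symmetric] diff_divide_distrib[symmetric])
  qed
  also have "\<dots> = 2 * integral {-pi..pi} (\<lambda>t. cos (real_of_int x * t) / R t)"
    by (rule integral_mult_right)
  finally show ?thesis unfolding pot G_def by (simp add: field_simps)
qed

text \<open>These summands are the covariances of single layers. The terms \<open>qk p k 0 0\<close>
  of the three potentials cancel.\<close>

lemma qk_second_difference_sums:
  "(\<lambda>k. 2 * qk p k x 0 - qk p k (x - 1) 0 - qk p k (x + 1) 0) sums G x"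
proof -
  have s: "(\<lambda>k. qk p k 0 0 - qk p k y 0) sums pot p y" for y
    unfolding pot_def using qk_difference_sums[of y] by (intro summable_sums) (auto simp: sums_iff)
  from sums_diff[OF sums_add[OF s[of "x - 1"] s[of "x + 1"]] sums_mult[OF s[of x], of 2]]
  show ?thesis unfolding pot_second_difference by (simp add: algebra_simps)
qed

lemma G_decay:
  obtains A c where "A > 0" "c > 0" "\<And>x. \<bar>G x\<bar> \<le> A * exp (- c * real_of_int \<bar>x\<bar>)"
proof -
  obtain A c where "A > 0" "c > 0" and b: "\<And>x. \<bar>integral {-pi..pi} (\<lambda>t. cos (real_of_int x * t) / R t)\<bar> \<le> A * exp (- c * real_of_int \<bar>x\<bar>)"
    using cos_poly_reciprocal_decay[OF cos_poly_R R_pos] by blast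
  then show ?thesis
  proof (intro that[of "A / pi" c])
    show "\<bar>G x\<bar> \<le> A / pi * exp (- c * real_of_int \<bar>x\<bar>)" for x
      using b[of x] by (simp add: G_def abs_mult divide_right_mono)
  qed simp_all
qed

lemma G_abs_summable: "Infinite_Sum.abs_summable_on G UNIV"
proof -
  obtain A c where "A > 0" "c > 0" and b: "\<And>x. \<bar>G x\<bar> \<le> A * exp (- c * real_of_int \<bar>x\<bar>)" using G_decay by blast
  have "(\<lambda>x. A * exp (- c * real_of_int \<bar>x\<bar>)) summable_on (UNIV :: int set)"
    by (intro summable_on_cmult_right exp_abs_summable \<open>c > 0\<close>)
  then show ?thesis
    by (rule summable_on_comparison_test) (use b in auto)
qed

text \<open>Multiplying 1 / R back by the cosine polynomial R convolves G with the coefficients of R,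
  and the result is a Kronecker delta.\<close>
lemma G_has_sum: "(G has_sum (1 / var_p p)) UNIV"
proof -
  have Gs: "G summable_on UNIV" using G_abs_summable by (rule abs_summable_summable)
  define T where "T = infsum G UNIV"
  have Gt: "(G has_sum T) UNIV" unfolding T_def using Gs by (rule has_sum_infsum)
  have shift: "((\<lambda>x. G (x + j)) has_sum T) UNIV" for j
    by (rule has_sum_reindex_bij_betw[THEN iffD2, OF _ Gt]) (rule bij_betw_byWitness[of _ "\<lambda>x. x - j"], auto)
  obtain c where c: "\<And>t. R t = (\<Sum>j\<in>{-(2*r)..2*r}. c j * cos (real_of_int j * t))"
    using cos_poly_R by (auto simp: cos_poly_def)
  have i: "(\<lambda>t. cos (real_of_int x * t) / R t) integrable_on {-pi..pi}" for x :: int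
    by (intro integrable_continuous_real continuous_intros) (use R_pos in force)
  have conv: "(\<Sum>j\<in>{-(2*r)..2*r}. c j / 2 * (G (x - j) + G (x + j))) = (if x = 0 then 2 else 0)" for x
  proof -
    have "(\<Sum>j\<in>{-(2*r)..2*r}. c j / 2 * (G (x - j) + G (x + j))) = 1 / pi * (\<Sum>j\<in>{-(2*r)..2*r}. c j / 2 *
       (integral {-pi..pi} (\<lambda>t. cos (real_of_int (x - j) * t) / R t) + integral {-pi..pi} (\<lambda>t. cos (real_of_int (x + j) * t) / R t)))"
      unfolding G_def sum_distrib_left by (intro sum.cong refl) (simp add: algebra_simps)
    also have "(\<Sum>j\<in>{-(2*r)..2*r}. c j / 2 *
       (integral {-pi..pi} (\<lambda>t. cos (real_of_int (x - j) * t) / R t) + integral {-pi..pi} (\<lambda>t. cos (real_of_int (x + j) * t) / R t)))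
       = integral {-pi..pi} (\<lambda>t. \<Sum>j\<in>{-(2*r)..2*r}. c j / 2 * (cos (real_of_int (x - j) * t) / R t + cos (real_of_int (x + j) * t) / R t))"
      by (intro integral_unique[symmetric] has_integral_sum has_integral_mult_right has_integral_add integrable_integral i finite_atLeastAtMost_int)
    also have "\<dots> = integral {-pi..pi} (\<lambda>t. cos (real_of_int x * t))"
    proof (rule integral_cong)
      fix t assume t: "t \<in> {-pi..pi}"
      have "(\<Sum>j\<in>{-(2*r)..2*r}. c j / 2 * (cos (real_of_int (x - j) * t) / R t + cos (real_of_int (x + j) * t) / R t))
        = (\<Sum>j\<in>{-(2*r)..2*r}. c j * (cos (real_of_int j * t) * cos (real_of_int x * t)) / R t)"
        unfolding cos_mult_cos by (intro sum.cong refl) (simp add: add_divide_distrib distrib_left)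
      also have "\<dots> = R t * cos (real_of_int x * t) / R t"
        by (simp add: c[of t] sum_distrib_right mult.assoc sum_divide_distrib)
      finally show "(\<Sum>j\<in>{-(2*r)..2*r}. c j / 2 * (cos (real_of_int (x - j) * t) / R t + cos (real_of_int (x + j) * t) / R t)) = cos (real_of_int x * t)"
        using R_pos[OF t] by simp
    qed
    finally show ?thesis using integral_unique[OF has_integral_cos_int[of x]] by simp
  qed
  \<comment> \<open>Every shifted copy of \<open>G\<close> has the same sum \<open>T\<close>, so the
    left side of \<open>conv\<close> sums to \<open>T\<close> times the sum of all
    \<open>c j\<close>, which is \<open>R 0\<close>. The right side sums to 2, that is 1 / pi times
    the length of the interval.\<close>
  have "((\<lambda>x. \<Sum>j\<in>{-(2*r)..2*r}. c j / 2 * (G (x - j) + G (x + j))) has_sum (\<Sum>j\<in>{-(2*r)..2*r}. c j / 2 * (T + T))) UNIV"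
  proof (intro has_sum_finite_sum has_sum_cmult_right has_sum_add shift)
    show "((\<lambda>x. G (x - j)) has_sum T) UNIV" for j using shift[of "- j"] by simp
  qed simp
  also have "(\<Sum>j\<in>{-(2*r)..2*r}. c j / 2 * (T + T)) = R 0 * T"
    by (simp add: c[of 0] sum_distrib_right)
  finally have "((\<lambda>x. if x = 0 then 2 else 0) has_sum (R 0 * T)) (UNIV :: int set)" unfolding conv .
  moreover have "((\<lambda>x. if x = 0 then 2 else 0) has_sum (2::real)) (UNIV :: int set)"
    using has_sum_finite_neutralI[of "{0::int}" UNIV "\<lambda>x. if x = 0 then 2 else 0" "2::real"] by simp
  ultimately have "R 0 * T = 2" by (rule has_sum_unique)
  then have "T = 1 / var_p p" using var_pos unfolding R_0 by (simp add: field_simps)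
  then show ?thesis using Gt by simp
qed

text \<open>After substituting x = a - b, the double sum factors into the characteristic function of
  \<open>p\<close> and its conjugate.\<close>

lemma phi_q_eq: "phi_q p t = complex_of_real (phi t)"
proof -
  have q: "qker p 0 x = (\<Sum>b\<in>S. p b * p (x + b))" for x
    unfolding qker_def by (subst infsum_finite_support[of S]) (auto simp: p_notin)
  let ?e = "\<lambda>x. exp (\<i> * complex_of_real (t * real_of_int x))"
  have "phi_q p t = (\<Sum>x\<in>{-2*r..2*r}. complex_of_real (qker p 0 x) * ?e x)"
    unfolding phi_q_def
  proof (rule infsum_finite_support)
    fix x assume x: "x \<notin> {-2*r..2*r}"
    have "p (x + b) = 0" if "b \<in> S" for b
      using x that by (intro p_support) auto
    then have "qker p 0 x = 0" unfolding q by (intro sum.neutral) simp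
    then show "complex_of_real (qker p 0 x) * ?e x = 0" by simp
  qed simp
  also have "\<dots> = (\<Sum>b\<in>S. \<Sum>x\<in>{-2*r..2*r}. complex_of_real (p b * p (x + b)) * ?e x)"
    unfolding q of_real_sum sum_distrib_right by (rule sum.swap)
  also have "\<dots> = (\<Sum>b\<in>S. \<Sum>a\<in>S. complex_of_real (p b * p a) * ?e (a - b))"
  proof (rule sum.cong[OF refl])
    fix b assume b: "b \<in> S"
    have "(\<Sum>x\<in>{-2*r..2*r}. complex_of_real (p b * p (x + b)) * ?e x) = (\<Sum>x\<in>{-r-b..r-b}. complex_of_real (p b * p (x + b)) * ?e x)"
      by (rule sum.mono_neutral_right) (use b in \<open>auto intro!: p_support\<close>)
    also have "\<dots> = (\<Sum>a\<in>S. complex_of_real (p b * p a) * ?e (a - b))"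
      by (rule sum.reindex_bij_witness[of _ "\<lambda>a. a - b" "\<lambda>x. x + b"]) auto
    finally show "(\<Sum>x\<in>{-2*r..2*r}. complex_of_real (p b * p (x + b)) * ?e x) = (\<Sum>a\<in>S. complex_of_real (p b * p a) * ?e (a - b))" .
  qed
  also have "\<dots> = (\<Sum>b\<in>S. complex_of_real (p b) * cnj (?e b)) * (\<Sum>a\<in>S. complex_of_real (p a) * ?e a)"
    unfolding sum_product by (intro sum.cong refl) (simp add: exp_cnj right_diff_distrib exp_diff exp_minus field_simps)
  also have "(\<Sum>b\<in>S. complex_of_real (p b) * cnj (?e b)) = cnj (\<Sum>a\<in>S. complex_of_real (p a) * ?e a)"
    by simp
  also have "(\<Sum>a\<in>S. complex_of_real (p a) * ?e a) = 
     Complex (\<Sum>a\<in>S. p a * cos (real_of_int a * t)) (\<Sum>a\<in>S. p a * sin (real_of_int a * t))"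
    by (simp add: complex_eq_iff Re_exp Im_exp mult.commute)
  finally show ?thesis
    by (simp add: complex_eq_iff phi_square power2_eq_square)
qed

lemma G_complex_integral:
  "((\<lambda>t. (1 - complex_of_real (cos t)) / (1 - phi_q p t) * exp (\<i> * complex_of_real (t * real_of_int x)))
     has_integral complex_of_real (pi * G x)) {-pi..pi}"
proof -
  have ic: "(\<lambda>t. cos (real_of_int x * t) / R t) integrable_on {-pi..pi}"
    by (intro integrable_continuous_real continuous_intros) (use R_pos in force)
  have isn: "(\<lambda>t. sin (real_of_int x * t) / R t) integrable_on {-pi..pi}"
    by (intro integrable_continuous_real continuous_intros) (use R_pos in force)
  have c: "((\<lambda>t. cos (real_of_int x * t) / R t) has_integral (pi * G x)) {-pi..pi}"
    using integrable_integral[OF ic] by (simp add: G_def)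
  let ?I = "integral {-pi..pi} (\<lambda>t. sin (real_of_int x * t) / R t)"
  have "?I = integral {-pi..pi} (\<lambda>t. sin (real_of_int x * (-t)) / R (-t))"
    using Henstock_Kurzweil_Integration.integral_reflect_real[of pi "-pi" "\<lambda>t. sin (real_of_int x * t) / R t"] by (simp only: minus_minus)
  \<comment> \<open>As \<open>R\<close> is even, the sine part of the coefficient is odd and
    integrates to 0.\<close>
  also have "\<dots> = - ?I" by (simp add: R_minus)
  finally have "?I = 0" by simp
  then have s: "((\<lambda>t. sin (real_of_int x * t) / R t) has_integral 0) {-pi..pi}"
    using integrable_integral[OF isn] by simp
  have "((\<lambda>t. complex_of_real (cos (real_of_int x * t) / R t) + \<i> * complex_of_real (sin (real_of_int x * t) / R t))
     has_integral (complex_of_real (pi * G x) + \<i> * complex_of_real 0)) {-pi..pi}"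
    by (intro has_integral_add has_integral_mult_right has_integral_of_real c s)
  then have *: "((\<lambda>t. complex_of_real (cos (real_of_int x * t) / R t) + \<i> * complex_of_real (sin (real_of_int x * t) / R t))
     has_integral (complex_of_real (pi * G x))) {-pi..pi}" by simp
  show ?thesis
  proof (rule has_integral_spike[OF _ _ *])
    \<comment> \<open>At 0 the quotient is 0 / 0, which evaluates to 0 instead of 1 / R 0, so the
      integrands agree only off this point.\<close>
    show "negligible {0::real}" by simp
    fix t assume t: "t \<in> {-pi..pi} - {0}"
    then have R: "R t > 0" and ne: "1 - cos t \<noteq> 0" using R_pos cos_eq_1_iff_pi[of t] by auto
    have "1 - phi_q p t = complex_of_real ((1 - cos t) * R t)"
      unfolding one_minus_cos_mult_R phi_q_eq by simp
    then have "(1 - complex_of_real (cos t)) / (1 - phi_q p t) = complex_of_real ((1 - cos t) / ((1 - cos t) * R t))"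
      by simp
    also have "\<dots> = complex_of_real (1 / R t)" using ne by simp
    finally have quot: "(1 - complex_of_real (cos t)) / (1 - phi_q p t) = complex_of_real (1 / R t)" .
    have euler: "exp (\<i> * complex_of_real (t * real_of_int x)) = Complex (cos (real_of_int x * t)) (sin (real_of_int x * t))"
      by (simp add: complex_eq_iff Re_exp Im_exp mult.commute)
    show "(1 - complex_of_real (cos t)) / (1 - phi_q p t) * exp (\<i> * complex_of_real (t * real_of_int x)) =
       complex_of_real (cos (real_of_int x * t) / R t) + \<i> * complex_of_real (sin (real_of_int x * t) / R t)"
      unfolding quot euler by (simp add: complex_eq_iff)
  qed
qed

end

section \<open>The noise series\<close>

context prob_space begin

lemma indep_vars_pair_expectation:
  fixes X :: "'i \<Rightarrow> 'a \<Rightarrow> real"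
  assumes ind: "indep_vars (\<lambda>_. borel) X I" and "i \<in> I" "j \<in> I" "i \<noteq> j"
    and "integrable M (X i)" "integrable M (X j)"
  shows "expectation (\<lambda>\<omega>. X i \<omega> * X j \<omega>) = expectation (X i) * expectation (X j)"
proof -
  have "indep_var (Pi\<^sub>M {i} (\<lambda>_. borel)) (\<lambda>\<omega>. restrict (\<lambda>i. X i \<omega>) {i}) (Pi\<^sub>M {j} (\<lambda>_. borel)) (\<lambda>\<omega>. restrict (\<lambda>i. X i \<omega>) {j})"
    by (rule indep_var_restrict[OF ind]) (use assms in auto)
  then have "indep_var borel ((\<lambda>f. f i) \<circ> (\<lambda>\<omega>. restrict (\<lambda>i. X i \<omega>) {i})) borel ((\<lambda>f. f j) \<circ> (\<lambda>\<omega>. restrict (\<lambda>i. X i \<omega>) {j}))"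
    by (rule indep_var_compose) auto
  then have "indep_var borel (X i) borel (X j)" by (simp add: comp_def)
  then show ?thesis using assms by (intro indep_var_lebesgue_integral) auto
qed

end

locale iid_noise = prob_space M for M :: "'a measure" +
  fixes \<xi> :: "int \<Rightarrow> int \<Rightarrow> 'a \<Rightarrow> real" and \<sigma>2 :: real
  assumes rv [measurable]: "\<xi> t x \<in> borel_measurable M"
    and indep: "indep_vars (\<lambda>_. borel) (\<lambda>(t, x). \<xi> t x) UNIV"
    and sq_int: "integrable M (\<lambda>\<omega>. (\<xi> t x \<omega>)\<^sup>2)"
    and mean: "expectation (\<xi> t x) = 0"
    and second_moment: "expectation (\<lambda>\<omega>. (\<xi> t x \<omega>)\<^sup>2) = \<sigma>2"
begin

lemma xi_int: "integrable M (\<xi> t x)"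
  by (rule square_integrable_integrable[OF rv sq_int])

lemma xi_covariance: "expectation (\<lambda>\<omega>. \<xi> t x \<omega> * \<xi> t y \<omega>) = (if x = y then \<sigma>2 else 0)"
proof (cases "x = y")
  case True
  then show ?thesis using second_moment[of t y] by (simp add: power2_eq_square)
next
  case False
  then show ?thesis
    using indep_vars_pair_expectation[OF indep, of "(t, x)" "(t, y)"] xi_int mean by simp
qed

context
  fixes Z :: "nat \<Rightarrow> int set" and w :: "nat \<Rightarrow> int \<Rightarrow> real"
  assumes finZ: "finite (Z k)"
begin

text \<open>The weights are arbitrary so that a linear combination of two such series is again one
  of them; the polarization below depends on this.\<close>

definition layer :: "nat \<Rightarrow> 'a \<Rightarrow> real" where
  "layer k \<omega> = (\<Sum>z\<in>Z k. \<xi> (- int k) z \<omega> * w k z)"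

lemma layer_measurable [measurable]: "layer k \<in> borel_measurable M"
  unfolding layer_def[abs_def] by measurable

text \<open>Different layers read the noise at different times, hence on disjoint blocks
  \<open>K k\<close> of the index set.\<close>

lemma layer_indep: "indep_vars (\<lambda>_. borel) layer UNIV"
proof -
  define K where "K k = Pair (- int k) ` Z k" for k
  have "indep_vars (\<lambda>k. Pi\<^sub>M (K k) (\<lambda>_. borel)) (\<lambda>k \<omega>. restrict (\<lambda>i. (case i of (t, x) \<Rightarrow> \<xi> t x) \<omega>) (K k)) UNIV"
    by (rule indep_vars_restrict[OF indep]) (auto simp: disjoint_family_on_def K_def)
  then have "indep_vars (\<lambda>_. borel) (\<lambda>k \<omega>. (\<lambda>f. \<Sum>z\<in>Z k. f (- int k, z) * w k z) (restrict (\<lambda>i. (case i of (t, x) \<Rightarrow> \<xi> t x) \<omega>) (K k))) UNIV"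
  proof (rule indep_vars_compose2)
    show "(\<lambda>f. \<Sum>z\<in>Z k. f (- int k, z) * w k z) \<in> borel_measurable (Pi\<^sub>M (K k) (\<lambda>_. borel))" for k
      by (intro borel_measurable_sum borel_measurable_times measurable_component_singleton borel_measurable_const) (auto simp: K_def)
  qed
  moreover have "(\<Sum>z\<in>Z k. (restrict (\<lambda>i. (case i of (t, x) \<Rightarrow> \<xi> t x) \<omega>) (K k)) (- int k, z) * w k z) = layer k \<omega>" for k \<omega>
    unfolding layer_def by (rule sum.cong) (auto simp: K_def)
  ultimately show ?thesis by simp
qed

lemma layer_sq_int: "integrable M (\<lambda>\<omega>. (layer k \<omega>)\<^sup>2)"
proof -
  have "integrable M (\<lambda>\<omega>. (\<xi> t z \<omega> * c)\<^sup>2)" for t z c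
    unfolding power_mult_distrib by (intro integrable_mult_left sq_int)
  then show ?thesis unfolding layer_def by (intro square_integrable_sum) auto
qed

lemma layer_mean: "expectation (layer k) = 0"
  unfolding layer_def by (subst Bochner_Integration.integral_sum) (auto intro: xi_int simp: mean)

lemma layer_second_moment: "expectation (\<lambda>\<omega>. (layer k \<omega>)\<^sup>2) = \<sigma>2 * (\<Sum>z\<in>Z k. (w k z)\<^sup>2)"
proof -
  have i: "integrable M (\<lambda>\<omega>. \<xi> t x \<omega> * \<xi> t y \<omega>)" for t x y
    by (rule square_integrable_mult) (auto intro: sq_int)
  have "(layer k \<omega>)\<^sup>2 = (\<Sum>x\<in>Z k. \<Sum>y\<in>Z k. (\<xi> (- int k) x \<omega> * \<xi> (- int k) y \<omega>) * (w k x * w k y))" for \<omega>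
    unfolding layer_def power2_eq_square sum_product by (simp only: mult_ac)
  then have "expectation (\<lambda>\<omega>. (layer k \<omega>)\<^sup>2) = (\<Sum>x\<in>Z k. \<Sum>y\<in>Z k. expectation (\<lambda>\<omega>. \<xi> (- int k) x \<omega> * \<xi> (- int k) y \<omega>) * (w k x * w k y))"
    using i by (simp add: Bochner_Integration.integral_sum)
  also have "\<dots> = (\<Sum>x\<in>Z k. \<sigma>2 * (w k x)\<^sup>2)"
    unfolding xi_covariance
    by (rule sum.cong) (auto simp: finZ power2_eq_square if_distrib[of "\<lambda>x. x * _"] sum.delta' cong: if_cong)
  finally show ?thesis by (simp add: sum_distrib_left)
qed

lemma layer_series:
  assumes "(\<lambda>k. \<Sum>z\<in>Z k. (w k z)\<^sup>2) sums s"
  shows "AE \<omega> in M. summable (\<lambda>k. layer k \<omega>)"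
    and "integrable M (\<lambda>\<omega>. (\<Sum>k. layer k \<omega>)\<^sup>2)"
    and "expectation (\<lambda>\<omega>. (\<Sum>k. layer k \<omega>)\<^sup>2) = \<sigma>2 * s"
proof -
  have v: "(\<lambda>k. expectation (\<lambda>\<omega>. (layer k \<omega>)\<^sup>2)) sums (\<sigma>2 * s)"
    unfolding layer_second_moment by (rule sums_mult[OF assms])
  note * = layer_indep layer_sq_int layer_mean sums_summable[OF v]
  show "AE \<omega> in M. summable (\<lambda>k. layer k \<omega>)" by (rule kolmogorov_one_series[OF *])
  show "integrable M (\<lambda>\<omega>. (\<Sum>k. layer k \<omega>)\<^sup>2)" by (rule indep_series_second_moment(1)[OF *])
  show "expectation (\<lambda>\<omega>. (\<Sum>k. layer k \<omega>)\<^sup>2) = \<sigma>2 * s"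
    using indep_series_second_moment(2)[OF *] sums_unique[OF v] by simp
qed

end

end

section \<open>The covariance of Delta_0 as a sum over layers\<close>

locale noisy_walk = iid_noise M \<xi> \<sigma>2 + finite_range_walk p r
  for M :: "'a measure" and \<xi> \<sigma>2 p r
begin

lemma V0_eq: "V0 M p \<xi> x = \<sigma>2 * G x"
proof -
  \<comment> \<open>One window for all four starting points 0, -1, x and x - 1: the margin |x| + 1
    is added to the range of \<open>k\<close> steps.\<close>
  define Z where "Z k = {-(int k * r + \<bar>x\<bar> + 1)..int k * r + \<bar>x\<bar> + 1}" for k
  define d where "d y k z = pk p k y z - pk p k (y - 1) z" for y k z
  have fin: "finite (Z k)" for k by (simp add: Z_def)
  have supp: "d y k z = 0" if "y = 0 \<or> y = x" "z \<notin> Z k" for y k z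
  proof -
    have "\<bar>z - y\<bar> > int k * r" "\<bar>z - (y - 1)\<bar> > int k * r"
      using that by (auto simp: Z_def)
    then show ?thesis by (simp add: d_def pk_support)
  qed
  define D where "D y = Delta0 p \<xi> y" for y
  have D: "D y \<omega> = (\<Sum>k. layer Z (d y) k \<omega>)" if "y = 0 \<or> y = x" for y \<omega>
    unfolding D_def Delta0_def d_def[symmetric] layer_def[OF fin]
    by (intro arg_cong[where f=suminf] ext infsum_finite_support[OF fin]) (simp add: supp[OF that])
  have cov: "(\<Sum>z\<in>Z k. d y k z * d y' k z) = 2 * qk p k (y - y') 0 - qk p k (y - y' - 1) 0 - qk p k (y - y' + 1) 0"
    if "y = 0 \<or> y = x" "y' = 0 \<or> y' = x" for y y' k
  proof -
    \<comment> \<open>Controlling one starting point is enough, because a site contributes only if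
      both walks can reach it.\<close>
    have Zsup: "(\<Sum>z\<in>Z k. pk p k a z * pk p k b z) = qk p k (a - b) 0" 
      if "a = y \<or> a = y - 1" for a b
      by (rule sum_pk_mult_pk[OF fin]) (use that \<open>y = 0 \<or> y = x\<close> in \<open>auto simp: Z_def\<close>)
    have "(\<Sum>z\<in>Z k. d y k z * d y' k z) = (\<Sum>z\<in>Z k. pk p k y z * pk p k y' z) - (\<Sum>z\<in>Z k. pk p k y z * pk p k (y' - 1) z)
       - (\<Sum>z\<in>Z k. pk p k (y - 1) z * pk p k y' z) + (\<Sum>z\<in>Z k. pk p k (y - 1) z * pk p k (y' - 1) z)"
      by (simp add: d_def algebra_simps sum.distrib sum_subtractf)
    also have "\<dots> = qk p k (y - y') 0 - qk p k (y - (y' - 1)) 0 - qk p k (y - 1 - y') 0 + qk p k (y - 1 - (y' - 1)) 0"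
      by (simp only: Zsup simp_thms)
    finally show ?thesis by (simp add: algebra_simps)
  qed
  have sums: "(\<lambda>k. \<Sum>z\<in>Z k. d y k z * d y' k z) sums G (y - y')" if "y = 0 \<or> y = x" "y' = 0 \<or> y' = x" for y y'
    unfolding cov[OF that] by (rule qk_second_difference_sums)
  have sq: "(\<lambda>k. \<Sum>z\<in>Z k. (d y k z)\<^sup>2) sums G 0" if "y = 0 \<or> y = x" for y
    using sums[OF that that] by (simp add: power2_eq_square)
  have ae: "AE \<omega> in M. summable (\<lambda>k. layer Z (d y) k \<omega>)" if "y = 0 \<or> y = x" for y
    by (rule layer_series(1)[OF fin sq[OF that]])
  have meas[measurable]: "D y \<in> borel_measurable M" if "y = 0 \<or> y = x" for y
  proof -
    have "(\<lambda>\<omega>. \<Sum>k. layer Z (d y) k \<omega>) \<in> borel_measurable M"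
      by (intro borel_measurable_suminf layer_measurable fin)
    then show ?thesis using D[OF that] by (simp add: fun_eq_iff[symmetric] cong: measurable_cong)
  qed
  \<comment> \<open>Second moments are only available for a single series, so the covariance is polarized.\<close>
  have polar: "integrable M (\<lambda>\<omega>. (D 0 \<omega> + s * D x \<omega>)\<^sup>2)"
     "expectation (\<lambda>\<omega>. (D 0 \<omega> + s * D x \<omega>)\<^sup>2) = \<sigma>2 * (G 0 + s\<^sup>2 * G 0 + 2 * s * G x)" for s
  proof -
    define w where "w k z = d 0 k z + s * d x k z" for k z
    \<comment> \<open>The mixed term is written with \<open>d x\<close> first, so that
      \<open>sums\<close> returns \<open>G x\<close> directly and not
      \<open>G (- x)\<close>.\<close>
    have "(\<Sum>z\<in>Z k. (w k z)\<^sup>2) = (\<Sum>z\<in>Z k. (d 0 k z)\<^sup>2) + s\<^sup>2 * (\<Sum>z\<in>Z k. (d x k z)\<^sup>2) + 2 * s * (\<Sum>z\<in>Z k. d x k z * d 0 k z)" for k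
      by (simp add: w_def power2_sum power_mult_distrib sum.distrib sum_distrib_left mult_ac)
    then have ws: "(\<lambda>k. \<Sum>z\<in>Z k. (w k z)\<^sup>2) sums (G 0 + s\<^sup>2 * G 0 + 2 * s * G x)"
      using sums_add[OF sums_add[OF sq[of 0] sums_mult[OF sq[of x], of "s\<^sup>2"]] sums_mult[OF sums[of x 0], of "2 * s"]]
      by simp
    have lw: "layer Z w k \<omega> = layer Z (d 0) k \<omega> + s * layer Z (d x) k \<omega>" for k \<omega>
      by (simp add: layer_def[OF fin] w_def sum.distrib sum_distrib_left algebra_simps)
    \<comment> \<open>\<open>suminf\<close> is additive only where both series converge, hence the
      equality holds almost surely.\<close>
    have ae': "AE \<omega> in M. (\<Sum>k. layer Z w k \<omega>)\<^sup>2 = (D 0 \<omega> + s * D x \<omega>)\<^sup>2"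
      using ae[of 0, simplified] ae[of x, simplified]
      by eventually_elim (simp add: lw D suminf_add[symmetric] suminf_mult summable_mult)
    have m1: "(\<lambda>\<omega>. (\<Sum>k. layer Z w k \<omega>)\<^sup>2) \<in> borel_measurable M"
      by (intro borel_measurable_power borel_measurable_suminf layer_measurable fin)
    have m2: "(\<lambda>\<omega>. (D 0 \<omega> + s * D x \<omega>)\<^sup>2) \<in> borel_measurable M" by simp
    show "integrable M (\<lambda>\<omega>. (D 0 \<omega> + s * D x \<omega>)\<^sup>2)"
      using layer_series(2)[OF fin ws] integrable_cong_AE[OF m1 m2 ae'] by simp
    show "expectation (\<lambda>\<omega>. (D 0 \<omega> + s * D x \<omega>)\<^sup>2) = \<sigma>2 * (G 0 + s\<^sup>2 * G 0 + 2 * s * G x)"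
      using layer_series(3)[OF fin ws] integral_cong_AE[OF m1 m2 ae'] by simp
  qed
  have "V0 M p \<xi> x = expectation (\<lambda>\<omega>. ((D 0 \<omega> + 1 * D x \<omega>)\<^sup>2 - (D 0 \<omega> + (-1) * D x \<omega>)\<^sup>2) / 4)"
    unfolding V0_def D_def by (intro Bochner_Integration.integral_cong refl) (simp add: power2_eq_square algebra_simps)
  also have "\<dots> = (\<sigma>2 * (G 0 + 1\<^sup>2 * G 0 + 2 * 1 * G x) - \<sigma>2 * (G 0 + (-1)\<^sup>2 * G 0 + 2 * (-1) * G x)) / 4"
    using polar[of 1] polar[of "-1"] by simp
  also have "\<dots> = \<sigma>2 * G x" by (simp add: algebra_simps)
  finally show ?thesis .
qed

end

section \<open>From the hypotheses to the two locales, and the claims read off from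
  \<open>G\<close>\<close>

theorem theorem2p6:
  fixes M :: "'a measure" and p :: "int \<Rightarrow> real" and \<xi> :: "int \<Rightarrow> int \<Rightarrow> 'a \<Rightarrow> real"
    and \<sigma>\<xi>2 :: real
  assumes "prob_space M"
    and p_range: "\<forall>x. 0 \<le> p x \<and> p x < 1"
    and p_sum: "(p has_sum 1) UNIV"
    and p_finite_range: "\<exists>R. \<forall>x. \<bar>x\<bar> > R \<longrightarrow> p x = 0"
    and p_span: "\<forall>u. int_subgroup_gen {u + x | x. p x > 0} = UNIV"
    and var_pos: "var_p p > 0"
    and xi_rv: "\<forall>t x. \<xi> t x \<in> borel_measurable M"
    and xi_indep: "prob_space.indep_vars M (\<lambda>_. borel) (\<lambda>(t, x). \<xi> t x) UNIV"
    and xi_ident: "\<forall>t x. distr M borel (\<xi> t x) = distr M borel (\<xi> 0 0)"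
    and xi_L2: "integrable M (\<lambda>\<omega>. (\<xi> 0 0 \<omega>)^2)"
    and xi_mean: "(\<integral>\<omega>. \<xi> 0 0 \<omega> \<partial>M) = 0"
    and xi_var: "\<sigma>\<xi>2 = (\<integral>\<omega>. (\<xi> 0 0 \<omega>)^2 \<partial>M)"
  shows "(\<exists>A c. 0 < A \<and> 0 < c \<and>
            (\<forall>x. \<bar>V0 M p \<xi> x\<bar> \<le> A * exp (- c * real_of_int \<bar>x\<bar>)))
      \<and> (\<forall>x. V0 M p \<xi> x = \<sigma>\<xi>2 * (pot p (x - 1) + pot p (x + 1) - 2 * pot p x))
      \<and> (\<forall>x. (\<lambda>\<theta>. (1 - complex_of_real (cos \<theta>)) / (1 - phi_q p \<theta>)
                     * exp (\<i> * complex_of_real (\<theta> * real_of_int x)))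
               integrable_on {- pi .. pi}
           \<and> complex_of_real (V0 M p \<xi> x) =
               complex_of_real (\<sigma>\<xi>2 / pi) *
               integral {- pi .. pi} (\<lambda>\<theta>. (1 - complex_of_real (cos \<theta>)) / (1 - phi_q p \<theta>)
                     * exp (\<i> * complex_of_real (\<theta> * real_of_int x))))
      \<and> Infinite_Sum.abs_summable_on (\<lambda>x. V0 M p \<xi> x) UNIV
      \<and> ((\<lambda>x. V0 M p \<xi> x) has_sum (\<sigma>\<xi>2 / var_p p)) UNIV"
proof -
  obtain r where r: "\<And>x. \<bar>x\<bar> > r \<Longrightarrow> p x = 0" using p_finite_range by blast
  have "finite_range_walk p r"
  proof
    show "(\<Sum>a\<in>{-r..r}. p a) = 1"
      using infsumI[OF p_sum] infsum_finite_support[of "{-r..r}" p] r by force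
  qed (use p_range r p_span var_pos in auto)
  moreover have "iid_noise M \<xi> \<sigma>\<xi>2"
  proof -
    interpret prob_space M by fact
    have [measurable]: "\<xi> t x \<in> borel_measurable M" for t x using xi_rv by blast
    \<comment> \<open>Integrability and moments depend only on the common law, so they pass from
      \<open>\<xi> 0 0\<close> to every site and time.\<close>
    have transfer_int: "integrable M (\<lambda>\<omega>. f (\<xi> t x \<omega>)) \<longleftrightarrow> integrable (distr M borel (\<xi> 0 0)) f"
      if "f \<in> borel_measurable borel" for f :: "real \<Rightarrow> real" and t x
      unfolding xi_ident[rule_format, of t x, symmetric]
      using integrable_distr_eq[of "\<xi> t x" M borel f] that by simp
    have transfer: "expectation (\<lambda>\<omega>. f (\<xi> t x \<omega>)) = integral\<^sup>L (distr M borel (\<xi> 0 0)) f"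
      if "f \<in> borel_measurable borel" for f :: "real \<Rightarrow> real" and t x
      unfolding xi_ident[rule_format, of t x, symmetric]
      using integral_distr[of "\<xi> t x" M borel f] that by simp
    show ?thesis
      using transfer_int[of "\<lambda>y. y\<^sup>2"] transfer[of "\<lambda>y. y\<^sup>2"] transfer[of "\<lambda>y. y"]
      by unfold_locales (use xi_indep xi_L2 xi_mean xi_var in auto)
  qed
  ultimately interpret noisy_walk M \<xi> \<sigma>\<xi>2 p r by (simp add: noisy_walk_def)
  have decay: "\<exists>A c. 0 < A \<and> 0 < c \<and> (\<forall>x. \<bar>V0 M p \<xi> x\<bar> \<le> A * exp (- c * real_of_int \<bar>x\<bar>))"
  proof -
    obtain A c where A: "A > 0" "c > 0" "\<And>x. \<bar>G x\<bar> \<le> A * exp (- c * real_of_int \<bar>x\<bar>)"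
      using G_decay by blast
    \<comment> \<open>Adding 1 keeps the constant positive when the noise variance is 0.\<close>
    have "\<bar>V0 M p \<xi> x\<bar> \<le> ((\<bar>\<sigma>\<xi>2\<bar> + 1) * A) * exp (- c * real_of_int \<bar>x\<bar>)" for x
    proof -
      have "\<bar>V0 M p \<xi> x\<bar> \<le> (\<bar>\<sigma>\<xi>2\<bar> + 1) * (A * exp (- c * real_of_int \<bar>x\<bar>))"
        unfolding V0_eq abs_mult using A by (intro mult_mono) auto
      then show ?thesis by (simp only: mult.assoc)
    qed
    moreover have "(\<bar>\<sigma>\<xi>2\<bar> + 1) * A > 0" using A by simp
    ultimately show ?thesis using A(2) by blast
  qed
  have summ: "Infinite_Sum.abs_summable_on (\<lambda>x. V0 M p \<xi> x) UNIV"
    unfolding V0_eq norm_mult by (intro summable_on_cmult_right G_abs_summable)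
  have hs: "((\<lambda>x. V0 M p \<xi> x) has_sum (\<sigma>\<xi>2 / var_p p)) UNIV"
    using has_sum_cmult_right[OF G_has_sum, of \<sigma>\<xi>2] unfolding V0_eq by simp
  show ?thesis
  proof (intro conjI decay summ hs allI)
    fix x
    show "V0 M p \<xi> x = \<sigma>\<xi>2 * (pot p (x - 1) + pot p (x + 1) - 2 * pot p x)"
      by (simp only: V0_eq pot_second_difference)
    note I = G_complex_integral[of x]
    show "(\<lambda>\<theta>. (1 - complex_of_real (cos \<theta>)) / (1 - phi_q p \<theta>)
            * exp (\<i> * complex_of_real (\<theta> * real_of_int x))) integrable_on {- pi .. pi}"
      by (rule has_integral_integrable[OF I])
    show "complex_of_real (V0 M p \<xi> x) = complex_of_real (\<sigma>\<xi>2 / pi) *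
            integral {- pi .. pi} (\<lambda>\<theta>. (1 - complex_of_real (cos \<theta>)) / (1 - phi_q p \<theta>)
              * exp (\<i> * complex_of_real (\<theta> * real_of_int x)))"
      unfolding integral_unique[OF I] V0_eq by simp
  qed
qed

end
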